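(* Let $Q\in\mathbb R$, $Q\neq0$. Let $\Theta$ be a minimal $L$-system with one-dimensional input-output space $\mathbb C$ and $J=1$ whose impedance function $V_\Theta(z)$ belongs to the class $\mathfrak M^Q$. Let $\Theta_\alpha$, $\alpha\in[0,\pi)$, be a non-trivial ($\alpha\neq\pi/2$) unimodular transformation of $\Theta$. Then $V_{\Theta_\alpha}(z)\in\mathfrak M^{-Q}$ if and only if $\tan\alpha=Q/2$.
   Context: $[X,Y]$ denotes the bounded linear operators from $X$ to $Y$; $\mathrm{Im}\,S=(S-S^* )/(2i)$, $\mathrm{Re}\,S=(S+S^* )/2$. **$L$-system with one-dimensional input-output.** Let $\dot A$ be a closed, densely defined symmetric operator with finite equal deficiency indices in a Hilbert space $\mathcal H$. Let $\mathcal H_+=\mathrm{Dom}(\dot A^* )$ with inner product $(f,g)_+=(f,g)+(\dot A^*f,\dot A^*g)$, and let $\mathcal H_+\subset\mathcal H\subset\mathcal H_-$ be the corresponding rigged Hilbert space ($\mathcal H_-$ is dual to $\mathcal H_+$ with respect to the pairing extending the inner product of $\mathcal H$), with the conjugate of $\mathcal H_\pm$ identified with $\mathcal H_\mp$. A quasi-self-adjoint extension of $\dot A$ is a non-symmetric operator $T$ with $\dot A\subset T\subset\dot A^*$; it belongs to $\Lambda(\dot A)$ if $\rho(T)\ne\emptyset$ and $\mathrm{Dom}(\dot A)=\mathrm{Dom}(T)\cap\mathrm{Dom}(T^* )$. An operator $\mathbb A\in[\mathcal H_+,\mathcal H_-]$ is a $( * )$-extension of $T$ if $\mathbb A\supset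 T\supset\dot A$, $\mathbb A^*\supset T^*\supset\dot A$, and the quasi-kernel $\hat A$ of $\mathrm{Re}\,\mathbb A$, i.e. the restriction of $\mathrm{Re}\,\mathbb A$ to $\{f\in\mathcal H_+:\mathrm{Re}\,\mathbb A f\in\mathcal H\}$, is self-adjoint in $\mathcal H$. An $L$-system with $E=\mathbb C$, $J=1$, $$\Theta=\begin{pmatrix}\mathbb A&K&1\\ \mathcal H_+\subset\mathcal H\subset\mathcal H_-&&\mathbb C\end{pmatrix},$$ consists of a $( * )$-extension $\mathbb A$ of some $T\in\Lambda(\dot A)$ (the main operator) and $K\in[\mathbb C,\mathcal H_-]$ with $\mathrm{Im}\,\mathbb A=KK^*$ and $\mathrm{Ran}(K)=\mathrm{Ran}(\mathrm{Im}\,\mathbb A)$. It is minimal if $\dot A$ is prime, i.e. there is no non-trivial reducing subspace of $\mathcal H$ on which $\dot A$ induces a self-adjoint operator. Its transfer function is $W_\Theta(z)=1-2iK^*(\mathbb A-zI)^{-1}K$, $z\in\rho(T)$, and its impedance function is $V_\Theta(z)=K^*(\mathrm{Re}\,\mathbb A-zI)^{-1}K$, $z\in\rho(\hat A)$ (both are known to be well defined, and $V_\Theta=i(W_\Theta-1)/(W_\Theta+1)$ for $\mathrm{Im}\,z\ne0$, $z\in\rho(T)$). **Unimodular transformation.** For $\alpha\in[0,\pi)$, an $L$-system with $E=\mathbb C$, $J=1$, $$\Theta_\alpha=\begin{pmatrix}\mathbb A_\alpha&K_\alpha&1\\ \mathcal H_+^{(\alpha)}\subset\mathcal H^{(\alpha)}\subset\mathcal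 H_-^{(\alpha)}&&\mathbb C\end{pmatrix}$$ (that is, $\mathcal H_+^{(\alpha)}\subset\mathcal H^{(\alpha)}\subset\mathcal H_-^{(\alpha)}$ is the rigged Hilbert space with $\mathcal H_+^{(\alpha)}=\mathrm{Dom}(\dot A_\alpha^* )$ for a closed, densely defined symmetric operator $\dot A_\alpha$ with finite equal deficiency indices in $\mathcal H^{(\alpha)}$, $\mathbb A_\alpha$ is a $( * )$-extension of some $T_\alpha\in\Lambda(\dot A_\alpha)$, and $K_\alpha\in[\mathbb C,\mathcal H_-^{(\alpha)}]$ with $\mathrm{Im}\,\mathbb A_\alpha=K_\alpha K_\alpha^*$ and $\mathrm{Ran}(K_\alpha)=\mathrm{Ran}(\mathrm{Im}\,\mathbb A_\alpha)$), with transfer function $W_{\Theta_\alpha}(z)=1-2iK_\alpha^*(\mathbb A_\alpha-zI)^{-1}K_\alpha$ and impedance function $V_{\Theta_\alpha}(z)=K_\alpha^*(\mathrm{Re}\,\mathbb A_\alpha-zI)^{-1}K_\alpha$, is a unimodular transformation of $\Theta$ if $W_{\Theta_\alpha}(z)=W_\Theta(z)\cdot(-e^{2i\alpha})$. The case $\alpha=\pi/2$ is the trivial one. **Class $\mathfrak M^Q$** ($Q\in\mathbb R$): scalar Herglotz–Nevanlinna functions $V$ (analytic maps of $\mathbb C_+$ into itself) admitting the representation $$V(z)=Q+\int_{\mathbb R}\left(\frac1{\lambda-z}-\frac{\lambda}{1+\lambda^2}\right)d\mu(\lambda),$$ where $\mu$ is an infinite Borel measure with $\int_{\mathbb R}\frac{d\mu(\lambda)}{1+\lambda^2}=1$.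 *)

theory Defs
  imports "HOL-Analysis.Analysis"
begin

section \<open>Complex Hilbert spaces\<close>

text \<open>The inner product is linear in the first and conjugate-linear in the second argument.\<close>

class chilbert_space = banach +
  fixes scaleC :: "complex \<Rightarrow> 'a \<Rightarrow> 'a" (infixr "*\<^sub>C" 75)
    and cinner :: "'a \<Rightarrow> 'a \<Rightarrow> complex"
  assumes scaleC_add_right: "a *\<^sub>C (x + y) = a *\<^sub>C x + a *\<^sub>C y"
    and scaleC_add_left: "(a + b) *\<^sub>C x = a *\<^sub>C x + b *\<^sub>C x"
    and scaleC_scaleC: "a *\<^sub>C (b *\<^sub>C x) = (a * b) *\<^sub>C x"
    and scaleC_of_real: "complex_of_real r *\<^sub>C x = scaleR r x"
    and cinner_commute: "cinner x y = cnj (cinner y x)"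
    and cinner_add_left: "cinner (x + y) z = cinner x z + cinner y z"
    and cinner_scaleC_left: "cinner (a *\<^sub>C x) y = a * cinner x y"
    and norm_eq_sqrt_cinner: "norm x = sqrt (Re (cinner x x))"

global_interpretation cvec:
  vector_space "scaleC :: complex \<Rightarrow> 'a \<Rightarrow> 'a::chilbert_space"
proof
  fix a b :: complex and x y :: 'a
  show "a *\<^sub>C (x + y) = a *\<^sub>C x + a *\<^sub>C y" by (rule scaleC_add_right)
  show "(a + b) *\<^sub>C x = a *\<^sub>C x + b *\<^sub>C x" by (rule scaleC_add_left)
  show "a *\<^sub>C (b *\<^sub>C x) = (a * b) *\<^sub>C x" by (rule scaleC_scaleC)
  show "1 *\<^sub>C x = x" using scaleC_of_real[of 1 x] by simp
qed

definition ortho_compl :: "'a::chilbert_space set \<Rightarrow> 'a set" where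
  "ortho_compl M = {x. \<forall>y\<in>M. cinner x y = 0}"

definition ortho_proj :: "'a::chilbert_space set \<Rightarrow> 'a \<Rightarrow> 'a" where
  "ortho_proj M x = (THE p. p \<in> M \<and> x - p \<in> ortho_compl M)"


section \<open>Unbounded operators\<close>

text \<open>
  An unbounded operator is identified with its graph: its domain is \<^const>\<open>Domain\<close>,
  extension of operators is inclusion, and an operator is closed iff its graph is closed.
\<close>

type_synonym 'a graph = "('a \<times> 'a) set"

definition linear_op :: "'a::chilbert_space graph \<Rightarrow> bool" where
  "linear_op G \<longleftrightarrow> single_valued G \<and> (0, 0) \<in> G \<and>
     (\<forall>(f, f') \<in> G. \<forall>(g, g') \<in> G. (f + g, f' + g') \<in> G) \<and>
     (\<forall>c. \<forall>(f, f') \<in> G. (c *\<^sub>C f, c *\<^sub>C f') \<in> G)"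

definition op_app :: "'a graph \<Rightarrow> 'a \<Rightarrow> 'a" where
  "op_app G f = (THE f'. (f, f') \<in> G)"

definition densely_defined :: "'a::chilbert_space graph \<Rightarrow> bool" where
  "densely_defined G \<longleftrightarrow> closure (Domain G) = UNIV"

text \<open>
  The adjoint of an operator acting in a closed subspace \<open>M\<close>, regarded as a Hilbert space
  in its own right.
\<close>

definition adjoint_in :: "'a::chilbert_space set \<Rightarrow> 'a graph \<Rightarrow> 'a graph" where
  "adjoint_in M G =
     {(g, g'). g \<in> M \<and> g' \<in> M \<and> (\<forall>(f, f') \<in> G. cinner f' g = cinner f g')}"

abbreviation adj :: "'a::chilbert_space graph \<Rightarrow> 'a graph" where
  "adj G \<equiv> adjoint_in UNIV G"

definition selfadjoint_in :: "'a::chilbert_space set \<Rightarrow> 'a graph \<Rightarrow> bool" where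
  "selfadjoint_in M G \<longleftrightarrow>
     linear_op G \<and> G \<subseteq> M \<times> M \<and> M \<subseteq> closure (Domain G) \<and> adjoint_in M G = G"

abbreviation selfadjoint :: "'a::chilbert_space graph \<Rightarrow> bool" where
  "selfadjoint G \<equiv> selfadjoint_in UNIV G"

definition resolvent_set :: "'a::chilbert_space graph \<Rightarrow> complex set" where
  "resolvent_set G = {z.
     (\<forall>h. \<exists>!f. (f, h + z *\<^sub>C f) \<in> G) \<and>
     (\<exists>C. \<forall>(f, f') \<in> G. norm f \<le> C * norm (f' - z *\<^sub>C f))}"

definition deficiency_space :: "'a::chilbert_space graph \<Rightarrow> complex \<Rightarrow> 'a set" where
  "deficiency_space G z = {f. (f, z *\<^sub>C f) \<in> adj G}"

definition fin_dim :: "'a::chilbert_space set \<Rightarrow> bool" where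
  "fin_dim S \<longleftrightarrow> (\<exists>B. finite B \<and> S \<subseteq> cvec.span B)"

definition finite_equal_deficiency :: "'a::chilbert_space graph \<Rightarrow> bool" where
  "finite_equal_deficiency G \<longleftrightarrow>
     fin_dim (deficiency_space G \<i>) \<and> fin_dim (deficiency_space G (-\<i>)) \<and>
     cvec.dim (deficiency_space G \<i>) = cvec.dim (deficiency_space G (-\<i>))"

definition admissible_symmetric :: "'a::chilbert_space graph \<Rightarrow> bool" where
  "admissible_symmetric A \<longleftrightarrow>
     linear_op A \<and> closed A \<and> densely_defined A \<and> A \<subseteq> adj A \<and> finite_equal_deficiency A"

definition reduces :: "'a::chilbert_space set \<Rightarrow> 'a graph \<Rightarrow> bool" where
  "reduces M G \<longleftrightarrow> cvec.subspace M \<and> closed M \<and>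
     (\<forall>(f, f') \<in> G. (ortho_proj M f, ortho_proj M f') \<in> G)"

definition prime_op :: "'a::chilbert_space graph \<Rightarrow> bool" where
  "prime_op G \<longleftrightarrow> \<not> (\<exists>M. M \<noteq> {0} \<and> reduces M G \<and> selfadjoint_in M (G \<inter> M \<times> M))"

definition quasi_selfadjoint_ext :: "'a::chilbert_space graph \<Rightarrow> 'a graph \<Rightarrow> bool" where
  "quasi_selfadjoint_ext A T \<longleftrightarrow> linear_op T \<and> \<not> T \<subseteq> adj T \<and> A \<subseteq> T \<and> T \<subseteq> adj A"

definition Lambda_class :: "'a::chilbert_space graph \<Rightarrow> 'a graph set" where
  "Lambda_class A = {T. quasi_selfadjoint_ext A T \<and>
     resolvent_set T \<noteq> {} \<and> Domain A = Domain T \<inter> Domain (adj T)}"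


section \<open>The rigged Hilbert space of a symmetric operator\<close>

text \<open>
  Throughout, the first argument \<open>A\<close> is the symmetric operator generating the triplet.
  The space \<open>H_minus\<close> is realised as the space of bounded conjugate-linear functionals on
  \<open>H_plus\<close>, with \<open>\<phi> f\<close> being the pairing of \<open>\<phi>\<close> with \<open>f\<close>; functionals are extensional, so
  that equality in \<open>H_minus\<close> is equality of functions.  The inclusion of the Hilbert space
  into \<open>H_minus\<close> is \<open>emb\<close>.
\<close>

definition H_plus :: "'a::chilbert_space graph \<Rightarrow> 'a set" where
  "H_plus A = Domain (adj A)"

definition inner_plus :: "'a::chilbert_space graph \<Rightarrow> 'a \<Rightarrow> 'a \<Rightarrow> complex" where
  "inner_plus A f g = cinner f g + cinner (op_app (adj A) f) (op_app (adj A) g)"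

definition norm_plus :: "'a::chilbert_space graph \<Rightarrow> 'a \<Rightarrow> real" where
  "norm_plus A f = sqrt (Re (inner_plus A f f))"

definition H_minus :: "'a::chilbert_space graph \<Rightarrow> ('a \<Rightarrow> complex) set" where
  "H_minus A = {\<phi> \<in> extensional (H_plus A).
     (\<forall>f\<in>H_plus A. \<forall>g\<in>H_plus A. \<phi> (f + g) = \<phi> f + \<phi> g) \<and>
     (\<forall>c. \<forall>f\<in>H_plus A. \<phi> (c *\<^sub>C f) = cnj c * \<phi> f) \<and>
     (\<exists>C. \<forall>f\<in>H_plus A. cmod (\<phi> f) \<le> C * norm_plus A f)}"

definition norm_minus :: "'a::chilbert_space graph \<Rightarrow> ('a \<Rightarrow> complex) \<Rightarrow> real" where
  "norm_minus A \<phi> = (SUP f\<in>{f \<in> H_plus A. norm_plus A f \<le> 1}. cmod (\<phi> f))"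

definition emb :: "'a::chilbert_space graph \<Rightarrow> 'a \<Rightarrow> ('a \<Rightarrow> complex)" where
  "emb A h = (\<lambda>g\<in>H_plus A. cinner h g)"

definition bounded_plus_minus ::
    "'a::chilbert_space graph \<Rightarrow> ('a \<Rightarrow> ('a \<Rightarrow> complex)) set" where
  "bounded_plus_minus A = {S.
     (\<forall>f\<in>H_plus A. S f \<in> H_minus A) \<and>
     (\<forall>f\<in>H_plus A. \<forall>g\<in>H_plus A. S (f + g) = (\<lambda>h\<in>H_plus A. S f h + S g h)) \<and>
     (\<forall>c. \<forall>f\<in>H_plus A. S (c *\<^sub>C f) = (\<lambda>h\<in>H_plus A. c * S f h)) \<and>
     (\<exists>C. \<forall>f\<in>H_plus A. norm_minus A (S f) \<le> C * norm_plus A f)}"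

definition bounded_scalar_minus ::
    "'a::chilbert_space graph \<Rightarrow> (complex \<Rightarrow> ('a \<Rightarrow> complex)) set" where
  "bounded_scalar_minus A = {K.
     (\<forall>c. K c \<in> H_minus A) \<and>
     (\<forall>c d. K (c + d) = (\<lambda>h\<in>H_plus A. K c h + K d h)) \<and>
     (\<forall>c d. K (c * d) = (\<lambda>h\<in>H_plus A. c * K d h)) \<and>
     (\<exists>C. \<forall>c. norm_minus A (K c) \<le> C * cmod c)}"

text \<open>
  Adjoint of an operator from \<open>H_plus\<close> to \<open>H_minus\<close>: the pairing of \<open>S\<^sup>* f\<close> with \<open>g\<close> is the
  complex conjugate of the pairing of \<open>S g\<close> with \<open>f\<close>.
\<close>

definition pm_adj ::
    "'a::chilbert_space graph \<Rightarrow> ('a \<Rightarrow> ('a \<Rightarrow> complex)) \<Rightarrow> 'a \<Rightarrow> ('a \<Rightarrow> complex)" where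
  "pm_adj A S f = (\<lambda>g\<in>H_plus A. cnj (S g f))"

definition pm_Re ::
    "'a::chilbert_space graph \<Rightarrow> ('a \<Rightarrow> ('a \<Rightarrow> complex)) \<Rightarrow> 'a \<Rightarrow> ('a \<Rightarrow> complex)" where
  "pm_Re A S f = (\<lambda>g\<in>H_plus A. (S f g + pm_adj A S f g) / 2)"

definition pm_Im ::
    "'a::chilbert_space graph \<Rightarrow> ('a \<Rightarrow> ('a \<Rightarrow> complex)) \<Rightarrow> 'a \<Rightarrow> ('a \<Rightarrow> complex)" where
  "pm_Im A S f = (\<lambda>g\<in>H_plus A. (S f g - pm_adj A S f g) / (2 * \<i>))"

definition pm_shift ::
    "'a::chilbert_space graph \<Rightarrow> ('a \<Rightarrow> ('a \<Rightarrow> complex)) \<Rightarrow> complex \<Rightarrow> 'a \<Rightarrow> ('a \<Rightarrow> complex)"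
  where
  "pm_shift A S z f = (\<lambda>g\<in>H_plus A. S f g - z * emb A f g)"

definition pm_inverse ::
    "'a::chilbert_space graph \<Rightarrow> ('a \<Rightarrow> ('a \<Rightarrow> complex)) \<Rightarrow> ('a \<Rightarrow> complex) \<Rightarrow> 'a" where
  "pm_inverse A S = inv_into (H_plus A) S"

text \<open>
  Adjoint of \<open>K\<close>, an operator from \<open>H_plus\<close> to the scalars: the pairing of \<open>K c\<close> with \<open>f\<close>
  equals \<open>c * cnj (K\<^sup>* f)\<close>, and \<open>c = 1\<close> determines \<open>K\<^sup>* f\<close>.
\<close>

definition K_adj :: "(complex \<Rightarrow> ('a \<Rightarrow> complex)) \<Rightarrow> 'a \<Rightarrow> complex" where
  "K_adj K f = cnj (K 1 f)"

definition quasi_kernel ::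
    "'a::chilbert_space graph \<Rightarrow> ('a \<Rightarrow> ('a \<Rightarrow> complex)) \<Rightarrow> 'a graph" where
  "quasi_kernel A S = {(f, h). f \<in> H_plus A \<and> S f = emb A h}"

definition pm_extends ::
    "'a::chilbert_space graph \<Rightarrow> ('a \<Rightarrow> ('a \<Rightarrow> complex)) \<Rightarrow> 'a graph \<Rightarrow> bool" where
  "pm_extends A S G \<longleftrightarrow> (\<forall>(f, f') \<in> G. f \<in> H_plus A \<and> S f = emb A f')"

definition star_extension ::
    "'a::chilbert_space graph \<Rightarrow> 'a graph \<Rightarrow> ('a \<Rightarrow> ('a \<Rightarrow> complex)) \<Rightarrow> bool" where
  "star_extension A T S \<longleftrightarrow> S \<in> bounded_plus_minus A \<and>
     pm_extends A S T \<and> A \<subseteq> T \<and>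
     pm_extends A (pm_adj A S) (adj T) \<and> A \<subseteq> adj T \<and>
     selfadjoint (quasi_kernel A (pm_Re A S))"


section \<open>L-systems\<close>

record 'a L_sys =
  sym_op :: "'a graph"
  main_op :: "'a graph"
  state_op :: "'a \<Rightarrow> ('a \<Rightarrow> complex)"
  channel_op :: "complex \<Rightarrow> ('a \<Rightarrow> complex)"

definition L_system :: "'a::chilbert_space L_sys \<Rightarrow> bool" where
  "L_system \<Theta> \<longleftrightarrow> admissible_symmetric (sym_op \<Theta>) \<and>
     main_op \<Theta> \<in> Lambda_class (sym_op \<Theta>) \<and>
     star_extension (sym_op \<Theta>) (main_op \<Theta>) (state_op \<Theta>) \<and>
     channel_op \<Theta> \<in> bounded_scalar_minus (sym_op \<Theta>) \<and>
     (\<forall>f\<in>H_plus (sym_op \<Theta>). pm_Im (sym_op \<Theta>) (state_op \<Theta>) f =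
        channel_op \<Theta> (K_adj (channel_op \<Theta>) f)) \<and>
     range (channel_op \<Theta>) = pm_Im (sym_op \<Theta>) (state_op \<Theta>) ` H_plus (sym_op \<Theta>)"

definition minimal_L_system :: "'a::chilbert_space L_sys \<Rightarrow> bool" where
  "minimal_L_system \<Theta> \<longleftrightarrow> L_system \<Theta> \<and> prime_op (sym_op \<Theta>)"

text \<open>
  Operators on the input-output space are scalars.  The transfer function is meaningful on
  the resolvent set of \<open>main_op\<close>, the impedance function on that of the quasi-kernel of the
  real part of \<open>state_op\<close>, which contains all non-real numbers.
\<close>

definition transfer_fun :: "'a::chilbert_space L_sys \<Rightarrow> complex \<Rightarrow> complex" where
  "transfer_fun \<Theta> z = 1 - 2 * \<i> * K_adj (channel_op \<Theta>)
     (pm_inverse (sym_op \<Theta>) (pm_shift (sym_op \<Theta>) (state_op \<Theta>) z) (channel_op \<Theta> 1))"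

definition impedance_fun :: "'a::chilbert_space L_sys \<Rightarrow> complex \<Rightarrow> complex" where
  "impedance_fun \<Theta> z = K_adj (channel_op \<Theta>)
     (pm_inverse (sym_op \<Theta>)
        (pm_shift (sym_op \<Theta>) (pm_Re (sym_op \<Theta>) (state_op \<Theta>)) z) (channel_op \<Theta> 1))"

definition unimodular_transformation ::
    "real \<Rightarrow> 'a::chilbert_space L_sys \<Rightarrow> 'b::chilbert_space L_sys \<Rightarrow> bool" where
  "unimodular_transformation \<alpha> \<Theta> \<Theta>\<^sub>\<alpha> \<longleftrightarrow> 0 \<le> \<alpha> \<and> \<alpha> < pi \<and> L_system \<Theta>\<^sub>\<alpha> \<and>
     (\<forall>z \<in> resolvent_set (main_op \<Theta>) \<inter> resolvent_set (main_op \<Theta>\<^sub>\<alpha>).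
        transfer_fun \<Theta>\<^sub>\<alpha> z = transfer_fun \<Theta> z * (- exp (2 * \<i> * complex_of_real \<alpha>)))"


section \<open>Herglotz--Nevanlinna functions\<close>

definition herglotz_nevanlinna :: "(complex \<Rightarrow> complex) \<Rightarrow> bool" where
  "herglotz_nevanlinna V \<longleftrightarrow>
     V holomorphic_on {z. Im z > 0} \<and> (\<forall>z. Im z > 0 \<longrightarrow> Im (V z) > 0)"

text \<open>Membership only constrains the values of the function on the upper half-plane.\<close>

definition M_class :: "real \<Rightarrow> (complex \<Rightarrow> complex) set" where
  "M_class Q = {V. herglotz_nevanlinna V \<and>
     (\<exists>\<mu> :: real measure. sets \<mu> = sets borel \<and> emeasure \<mu> UNIV = \<infinity> \<and>
        (\<integral>\<^sup>+ l. ennreal (1 / (1 + l\<^sup>2)) \<partial>\<mu>) = 1 \<and>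
        (\<forall>z. Im z > 0 \<longrightarrow> V z = complex_of_real Q +
           (LINT l|\<mu>. 1 / (complex_of_real l - z) - complex_of_real (l / (1 + l\<^sup>2)))))}"

end

theory Submission
  imports Defs "HOL-Probability.Probability" "HOL-Complex_Analysis.Complex_Analysis"
begin

text \<open>
  Write \<open>V\<close> and \<open>F\<close> for the impedance functions of the system and of its transformation, and
  \<open>t = tan \<alpha>\<close>.  The transfer function is the Cayley transform \<open>(1 - iV) / (1 + iV)\<close> of the impedance
  function, and multiplying a Cayley transform by \<open>- exp (2i\<alpha>)\<close> is a real Moebius transformation
  of the function.  After division by \<open>cos \<alpha>\<close>, which vanishes only in the trivial case, it becomes
  the symmetric relation
    \<open>(F(z) + t) (V(z) - t) = - (1 + t\<^sup>2)\<close> for \<open>Im z > 0\<close>.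
  Evaluating a Nevanlinna representation with normalised measure at \<open>i\<close> gives \<open>Q + i\<close>, so
  \<open>V(i) = Q + i\<close>.  If \<open>F\<close> has constant \<open>-Q\<close> then \<open>F(i) = -Q + i\<close>, and the relation at \<open>i\<close> reduces to
  \<open>(Q - t)\<^sup>2 = t\<^sup>2\<close>, that is, \<open>t = Q / 2\<close>.  Conversely \<open>t = Q / 2\<close> forces \<open>F(i) = -Q + i\<close>, and what
  remains is that \<open>F\<close> inherits a representation with infinite measure and no linear term
  (\<open>M_class_moebius\<close>).

  The relation (\<open>unimodular_impedance_relation\<close>) is proved on the operator side.  Let \<open>S\<close> be the
  state operator and \<open>T\<close> the main operator.  As \<open>T\<close> is not symmetric, the channel does not vanish on its domain; subtracting the resolvent of
  the self-adjoint quasi-kernel then solves \<open>(Re S - z) f = K 1\<close> for every non-real \<open>z\<close>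
  (\<open>ex1_impedance_vector\<close>).  Hence \<open>V\<close> is defined off the real axis, with \<open>V(cnj z) = cnj (V z)\<close> and
  \<open>Im V\<close> of the sign of \<open>Im z\<close>.  Points of the upper half-plane where \<open>V = i\<close> are eigenvalues of \<open>T\<close>, but
  the whole lower half-plane lies in the resolvent set of \<open>T\<close> (\<open>lower_half_plane_resolvent\<close>).  The two
  transfer functions are therefore compared there, and the relation, having real coefficients, is
  carried to the upper half-plane by conjugation.

  The inheritance is function theory.  A Herglotz function with value of imaginary part \<open>1\<close> at \<open>i\<close> is
  transported to the disc, where the Schwarz integral formula on smaller circles and a weak limit of
  probability measures give a representing measure (\<open>Herglotz_representation_disc\<close>).  Back on the
  line, the mass of the boundary point corresponding to infinity is the coefficient of the linear
  term.  For \<open>V\<close> with infinite measure and no linear term, \<open>y Im V(iy)\<close> tends to infinity and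
  \<open>Im V(iy) / y\<close> to zero (\<open>M_class_asymptotics\<close>).  The first fact excludes a linear term in \<open>F\<close>.  If the
  measure of \<open>F\<close> were finite, \<open>F(iy)\<close> would be a real constant plus \<open>O(1/y)\<close>, and one of the two facts
  would fail, according to whether that constant differs from \<open>-t\<close> or not.
\<close>

section \<open>Complex Hilbert spaces\<close>

lemma cinner_add_right: "cinner x (y + z) = cinner x y + cinner x (z::'a::chilbert_space)"
  by (metis cinner_add_left cinner_commute complex_cnj_add)

lemma cinner_scaleC_right: "cinner x (a *\<^sub>C y) = cnj a * cinner x (y::'a::chilbert_space)"
  by (metis cinner_commute cinner_scaleC_left complex_cnj_mult)

lemma cinner_zero_left [simp]: "cinner 0 (x::'a::chilbert_space) = 0"
  by (metis add_cancel_right_left add_0 cinner_add_left)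

lemma cinner_zero_right [simp]: "cinner (x::'a::chilbert_space) 0 = 0"
  by (metis cinner_commute cinner_zero_left complex_cnj_zero)

lemma cinner_minus_left [simp]: "cinner (- x) y = - cinner x (y::'a::chilbert_space)"
  by (metis add_eq_0_iff cinner_add_left cinner_zero_left)

lemma cinner_minus_right [simp]: "cinner x (- y) = - cinner x (y::'a::chilbert_space)"
  by (metis add_eq_0_iff cinner_add_right cinner_zero_right)

lemma cinner_diff_left: "cinner (x - y) z = cinner x z - cinner y (z::'a::chilbert_space)"
  using cinner_add_left[of x "- y" z] by simp

lemma cinner_diff_right: "cinner x (y - z) = cinner x y - cinner x (z::'a::chilbert_space)"
  using cinner_add_right[of x y "- z"] by simp

lemmas cinner_simps = cinner_add_left cinner_add_right cinner_diff_left cinner_diff_right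
  cinner_scaleC_left cinner_scaleC_right

lemma Im_cinner_self [simp]: "Im (cinner x (x::'a::chilbert_space)) = 0"
proof -
  have "Im (cinner x x) = Im (cnj (cinner x x))"
    using cinner_commute[of x x] by simp
  then show ?thesis by simp
qed

lemma Re_cinner_self: "Re (cinner x (x::'a::chilbert_space)) = (norm x)\<^sup>2"
proof (cases "Re (cinner x x) \<ge> 0")
  case True
  then show ?thesis by (simp add: norm_eq_sqrt_cinner)
next
  case False
  then have "sqrt (Re (cinner x x)) < 0" by simp
  then show ?thesis using norm_ge_zero[of x] norm_eq_sqrt_cinner[of x] by linarith
qed

lemma cinner_self: "cinner x x = complex_of_real ((norm (x::'a::chilbert_space))\<^sup>2)"
  by (simp add: complex_eq_iff Re_cinner_self)

lemma norm_scaleC [simp]: "norm (c *\<^sub>C x) = cmod c * norm (x::'a::chilbert_space)"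
proof -
  have "(norm (c *\<^sub>C x))\<^sup>2 = Re (c * cnj c * cinner x x)"
    by (simp add: Re_cinner_self[symmetric] cinner_simps mult_ac)
  also have "\<dots> = (cmod c * norm x)\<^sup>2"
    by (simp add: complex_norm_square[symmetric] cinner_self power_mult_distrib del: of_real_power)
  finally show ?thesis
    by (metis abs_ge_zero norm_ge_zero power2_eq_imp_eq zero_le_mult_iff)
qed

lemma norm_diff_square:
  "(norm (x - y))\<^sup>2 = (norm x)\<^sup>2 + (norm y)\<^sup>2 - 2 * Re (cinner x (y::'a::chilbert_space))"
proof -
  have "Re (cinner y x) = Re (cinner x y)"
    using cinner_commute[of y x] by simp
  then show ?thesis by (simp add: Re_cinner_self[symmetric] cinner_simps)
qed

lemma norm_add_square:
  "(norm (x + y))\<^sup>2 = (norm x)\<^sup>2 + (norm y)\<^sup>2 + 2 * Re (cinner x (y::'a::chilbert_space))"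
  using norm_diff_square[of x "- y"] by simp

text \<open>If the component of \<open>u\<close> along \<open>v\<close> were not zero, removing it would shorten \<open>u\<close>.\<close>

lemma cinner_eq_0_if_norm_minimal:
  fixes u v :: "'a::chilbert_space"
  assumes "\<And>c. norm u \<le> norm (u - c *\<^sub>C v)"
  shows "cinner u v = 0"
proof (cases "v = 0")
  case False
  define c where "c = cinner u v / complex_of_real ((norm v)\<^sup>2)"
  have nv: "(norm v)\<^sup>2 > 0" using False by simp
  have "(norm u)\<^sup>2 \<le> (norm (u - c *\<^sub>C v))\<^sup>2"
    using assms[of c] by (simp add: power_mono)
  also have "\<dots> = (norm u)\<^sup>2 + (cmod c)\<^sup>2 * (norm v)\<^sup>2 - 2 * Re (cnj c * cinner u v)"
    by (simp add: norm_diff_square cinner_simps power_mult_distrib)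
  also have "cnj c * cinner u v = complex_of_real ((cmod (cinner u v))\<^sup>2 / (norm v)\<^sup>2)"
    unfolding c_def by (simp add: mult.commute[of "cnj (cinner u v)"] complex_norm_square del: of_real_power)
  also have "(cmod c)\<^sup>2 * (norm v)\<^sup>2 = (cmod (cinner u v))\<^sup>2 / (norm v)\<^sup>2"
    using nv unfolding c_def by (simp add: norm_divide power_divide field_simps power2_eq_square[of "(norm v)\<^sup>2"]
      del: of_real_power)
  finally have "(cmod (cinner u v))\<^sup>2 / (norm v)\<^sup>2 \<le> 0" by simp
  then show ?thesis using nv by (simp add: divide_le_0_iff)
qed simp

lemma Cauchy_Schwarz_cinner: "cmod (cinner x y) \<le> norm x * norm (y::'a::chilbert_space)"
proof (cases "y = 0")
  case False
  define c where "c = cinner x y / complex_of_real ((norm y)\<^sup>2)"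
  have ny: "(norm y)\<^sup>2 > 0" using False by simp
  have "0 \<le> (norm (x - c *\<^sub>C y))\<^sup>2" by simp
  also have "\<dots> = (norm x)\<^sup>2 + (cmod c)\<^sup>2 * (norm y)\<^sup>2 - 2 * Re (cnj c * cinner x y)"
    by (simp add: norm_diff_square cinner_simps power_mult_distrib)
  also have "cnj c * cinner x y = complex_of_real ((cmod (cinner x y))\<^sup>2 / (norm y)\<^sup>2)"
    unfolding c_def by (simp add: mult.commute[of "cnj (cinner x y)"] complex_norm_square del: of_real_power)
  also have "(cmod c)\<^sup>2 * (norm y)\<^sup>2 = (cmod (cinner x y))\<^sup>2 / (norm y)\<^sup>2"
    using ny unfolding c_def by (simp add: norm_divide power_divide field_simps power2_eq_square[of "(norm y)\<^sup>2"]
      del: of_real_power)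
  finally have "(cmod (cinner x y))\<^sup>2 / (norm y)\<^sup>2 \<le> (norm x)\<^sup>2" by simp
  then have "(cmod (cinner x y))\<^sup>2 \<le> (norm x * norm y)\<^sup>2"
    using ny by (simp add: divide_le_eq power_mult_distrib)
  then show ?thesis by (rule power2_le_imp_le) simp
qed simp

lemma tendsto_cinner_right:
  fixes y :: "'a::chilbert_space"
  assumes "(g \<longlongrightarrow> y) F"
  shows "((\<lambda>n. cinner x (g n)) \<longlongrightarrow> cinner x y) F"
proof -
  have "((\<lambda>n. norm x * norm (g n - y)) \<longlongrightarrow> 0) F"
    by (intro tendsto_mult_right_zero tendsto_norm_zero LIM_zero assms)
  then have "((\<lambda>n. cinner x (g n) - cinner x y) \<longlongrightarrow> 0) F"
    by (rule Lim_null_comparison[rotated])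
       (auto simp: cinner_diff_right[symmetric] intro!: always_eventually Cauchy_Schwarz_cinner)
  then show ?thesis by (rule LIM_zero_cancel)
qed

text \<open>The projection theorem: by the parallelogram law a sequence in \<open>M\<close> minimising the distance to \<open>x\<close>
  is Cauchy, and the difference of \<open>x\<close> and its limit is orthogonal to \<open>M\<close>.\<close>

lemma closed_subspace_orthogonal_vector:
  fixes M :: "'a::chilbert_space set"
  assumes sub: "cvec.subspace M" and cl: "closed M" and xM: "x \<notin> M"
  obtains u where "u \<noteq> 0" "\<And>y. y \<in> M \<Longrightarrow> cinner u y = 0"
proof -
  define D where "D = (\<lambda>y. (norm (x - y))\<^sup>2) ` M"
  define d where "d = Inf D"
  have M0: "0 \<in> M" using sub by (simp add: cvec.subspace_def)
  have bdd: "bdd_below D" unfolding D_def by (rule bdd_belowI[of _ 0]) auto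
  have d_le: "d \<le> (norm (x - y))\<^sup>2" if "y \<in> M" for y
    unfolding d_def by (rule cInf_lower) (use that bdd in \<open>auto simp: D_def\<close>)
  have "\<exists>y\<in>M. (norm (x - y))\<^sup>2 < d + 1 / real (Suc n)" for n
  proof -
    have "Inf D < d + 1 / real (Suc n)" by (simp add: d_def)
    moreover have "D \<noteq> {}" using M0 by (auto simp: D_def)
    ultimately show ?thesis using cInf_lessD[of D] by (auto simp: D_def)
  qed
  then obtain y where yM: "\<And>n. y n \<in> M" and y: "\<And>n. (norm (x - y n))\<^sup>2 < d + 1 / real (Suc n)"
    by metis
  \<comment> \<open>The midpoint of two points of the subspace lies in it, so its distance from \<open>x\<close> is at least the infimum.\<close>
  have para: "(norm (y m - y n))\<^sup>2 \<le> 2 * (1 / real (Suc m)) + 2 * (1 / real (Suc n))" for m n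
  proof -
    define a where "a = x - y m"
    define b where "b = x - y n"
    have "(1/2) *\<^sub>C (y m + y n) \<in> M"
      using sub yM by (auto simp: cvec.subspace_def)
    then have "d \<le> (norm (x - (1/2) *\<^sub>C (y m + y n)))\<^sup>2" by (rule d_le)
    also have "x - (1/2) *\<^sub>C (y m + y n) = (1/2) *\<^sub>C (a + b)"
    proof -
      have "(1/2) *\<^sub>C (x + x) = x"
        using cvec.scale_left_distrib[of "1/2" "1/2" x] by (simp add: cvec.scale_right_distrib)
      then show ?thesis
        by (simp add: a_def b_def cvec.scale_right_distrib cvec.scale_right_diff_distrib)
    qed
    also have "(norm ((1/2) *\<^sub>C (a + b)))\<^sup>2 = (norm (a + b))\<^sup>2 / 4"
      by (simp add: power_mult_distrib norm_divide power_divide)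
    finally have "4 * d \<le> (norm (a + b))\<^sup>2" by simp
    moreover have "(norm (b - a))\<^sup>2 + (norm (a + b))\<^sup>2 = 2 * (norm a)\<^sup>2 + 2 * (norm b)\<^sup>2"
      using norm_diff_square[of b a] norm_add_square[of b a] by (simp add: add.commute)
    moreover have "(norm a)\<^sup>2 < d + 1 / real (Suc m)" "(norm b)\<^sup>2 < d + 1 / real (Suc n)"
      unfolding a_def b_def by (rule y)+
    ultimately have "(norm (b - a))\<^sup>2 \<le> 2 * (1 / real (Suc m)) + 2 * (1 / real (Suc n))"
      by linarith
    then show ?thesis by (simp add: a_def b_def)
  qed
  have "Cauchy y"
  proof (rule metric_CauchyI)
    fix e :: real assume e: "e > 0"
    obtain N where N: "4 * (1 / real (Suc N)) < e\<^sup>2"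
    proof -
      from reals_Archimedean[of "e\<^sup>2 / 4"] e obtain N where "inverse (real (Suc N)) < e\<^sup>2 / 4"
        by auto
      then have "4 * (1 / real (Suc N)) < e\<^sup>2" unfolding inverse_eq_divide by linarith
      then show thesis by (rule that)
    qed
    have "dist (y m) (y n) < e" if "m \<ge> N" "n \<ge> N" for m n
    proof -
      have "1 / real (Suc m) \<le> 1 / real (Suc N)" "1 / real (Suc n) \<le> 1 / real (Suc N)"
        using that by (auto intro!: divide_left_mono)
      then have "(norm (y m - y n))\<^sup>2 < e\<^sup>2"
        using para[of m n] N by linarith
      then show ?thesis using e by (simp add: dist_norm power_less_imp_less_base)
    qed
    then show "\<exists>N. \<forall>m\<ge>N. \<forall>n\<ge>N. dist (y m) (y n) < e" by blast
  qed
  then obtain p where p: "y \<longlonglongrightarrow> p" using Cauchy_convergent convergent_def by blast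
  have pM: "p \<in> M" using closed_sequentially[OF cl _ p] yM by blast
  have "(\<lambda>n. (norm (x - y n))\<^sup>2) \<longlonglongrightarrow> (norm (x - p))\<^sup>2"
    by (intro tendsto_intros p)
  moreover have "(\<lambda>n. d + 1 / real (Suc n)) \<longlonglongrightarrow> d + 0"
    by (intro tendsto_intros LIMSEQ_Suc[OF lim_1_over_n])
  ultimately have le: "(norm (x - p))\<^sup>2 \<le> d + 0"
    by (rule LIMSEQ_le) (use y in \<open>auto intro: less_imp_le\<close>)
  have min: "norm (x - p) \<le> norm (x - v)" if "v \<in> M" for v
    using order_trans[OF le[unfolded add_0_right] d_le[OF that]] by (rule power2_le_imp_le) simp
  show thesis
  proof
    show "x - p \<noteq> 0" using pM xM by auto
    show "cinner (x - p) v = 0" if "v \<in> M" for v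
    proof (rule cinner_eq_0_if_norm_minimal)
      fix c
      have "p + c *\<^sub>C v \<in> M" using sub pM that by (auto simp: cvec.subspace_def)
      from min[OF this] show "norm (x - p) \<le> norm (x - p - c *\<^sub>C v)" by (simp add: diff_diff_eq)
    qed
  qed
qed

text \<open>A vector orthogonal to the kernel, suitably scaled, represents the functional, because
  \<open>\<psi> u x - \<psi> x u\<close> lies in the kernel.\<close>

theorem Riesz_representation:
  fixes \<psi> :: "'a::chilbert_space \<Rightarrow> complex"
  assumes add: "\<And>x y. \<psi> (x + y) = \<psi> x + \<psi> y"
    and scale: "\<And>c x. \<psi> (c *\<^sub>C x) = c * \<psi> x"
    and bound: "\<And>x. cmod (\<psi> x) \<le> C * norm x"
  obtains v where "\<And>x. \<psi> x = cinner x v"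
proof (cases "\<forall>x. \<psi> x = 0")
  case True
  then show thesis using that[of 0] by simp
next
  case False
  then obtain x0 where x0: "\<psi> x0 \<noteq> 0" by blast
  have diff: "\<psi> (x - y) = \<psi> x - \<psi> y" for x y
    using add[of "x - y" y] by simp
  define M where "M = {x. \<psi> x = 0}"
  have sub: "cvec.subspace M"
    unfolding cvec.subspace_def M_def using scale[of 0 0] by (auto simp: add scale)
  have "closed M"
    unfolding closed_sequential_limits
  proof (intro allI impI, elim conjE)
    fix s l assume s: "\<forall>n. s n \<in> M" "s \<longlonglongrightarrow> l"
    have "(\<lambda>n. C * norm (l - s n)) \<longlonglongrightarrow> C * norm (l - l)"
      by (intro tendsto_intros s)
    moreover have "cmod (\<psi> l) \<le> C * norm (l - s n)" for n
      using bound[of "l - s n"] s by (simp add: diff M_def)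
    ultimately have "cmod (\<psi> l) \<le> C * norm (l - l)"
      by (intro LIMSEQ_le_const[of _ "C * norm (l - l)"]) auto
    then show "l \<in> M" by (simp add: M_def)
  qed
  have "x0 \<notin> M" using x0 by (simp add: M_def)
  then obtain u where u: "u \<noteq> 0" "\<And>y. y \<in> M \<Longrightarrow> cinner u y = 0"
    using closed_subspace_orthogonal_vector[OF sub \<open>closed M\<close>] by metis
  define n where "n = complex_of_real ((norm u)\<^sup>2)"
  have n0: "n \<noteq> 0" using u(1) by (simp add: n_def)
  have "\<psi> x = cinner x ((cnj (\<psi> u) / cnj n) *\<^sub>C u)" for x
  proof -
    have "\<psi> u *\<^sub>C x - \<psi> x *\<^sub>C u \<in> M"
      by (simp add: M_def diff scale)
    from u(2)[OF this] have "cnj (cinner u (\<psi> u *\<^sub>C x - \<psi> x *\<^sub>C u)) = 0" by simp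
    then have "\<psi> u * cinner x u = \<psi> x * cinner u u"
      by (simp add: cinner_commute[symmetric] cinner_simps)
    then show ?thesis using n0 unfolding n_def cinner_self
      by (simp add: cinner_simps field_simps)
  qed
  then show thesis by (rule that)
qed

section \<open>Adjoints and resolvents of unbounded operators\<close>

lemma linear_op_add: "linear_op G \<Longrightarrow> (f, f') \<in> G \<Longrightarrow> (g, g') \<in> G \<Longrightarrow> (f + g, f' + g') \<in> G"
  by (auto simp: linear_op_def)

lemma linear_op_scale: "linear_op G \<Longrightarrow> (f, f') \<in> G \<Longrightarrow> (c *\<^sub>C f, c *\<^sub>C f') \<in> G"
  by (auto simp: linear_op_def)

lemma linear_op_diff:
  assumes "linear_op G" "(f, f') \<in> G" "(g, g') \<in> G"
  shows "(f - g, f' - g') \<in> G"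
proof -
  have "(- g, - g') \<in> G"
    using linear_op_scale[OF assms(1,3), of "-1"] by (simp add: cvec.scale_minus_left)
  from linear_op_add[OF assms(1,2) this] show ?thesis by simp
qed

lemma adj_iff: "(g, g') \<in> adj G \<longleftrightarrow> (\<forall>(f, f') \<in> G. cinner f' g = cinner f g')"
  by (auto simp: adjoint_in_def)

lemma adjD: "(g, g') \<in> adj G \<Longrightarrow> (f, f') \<in> G \<Longrightarrow> cinner f' g = cinner f g'"
  by (auto simp: adj_iff)

lemma adj_add: "(f, f') \<in> adj G \<Longrightarrow> (g, g') \<in> adj G \<Longrightarrow> (f + g, f' + g') \<in> adj G"
  unfolding adj_iff[of "f + g"] by (clarsimp simp: cinner_simps adjD)

lemma adj_scale: "(f, f') \<in> adj G \<Longrightarrow> (c *\<^sub>C f, c *\<^sub>C f') \<in> adj G"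
  unfolding adj_iff[of "c *\<^sub>C f"] by (clarsimp simp: cinner_simps adjD)

text \<open>The form of a symmetric operator is real, so the imaginary part of the form of \<open>f' - z f\<close> comes
  from \<open>z\<close> alone.\<close>

lemma symmetric_lower_bound:
  assumes sym: "G \<subseteq> adj G" and "(f, f') \<in> G"
  shows "\<bar>Im z\<bar> * norm f \<le> norm (f' - z *\<^sub>C f)"
proof (cases "f = 0")
  case False
  have "cinner f' f = cnj (cinner f' f)"
  proof -
    have "(f, f') \<in> adj G" using assms by blast
    then have "cinner f' f = cinner f f'" using assms(2) by (auto simp: adj_iff)
    then show ?thesis by (metis cinner_commute)
  qed
  then have "Im (cinner f' f) = 0"
    by (simp add: complex_eq_iff)
  then have "\<bar>Im z\<bar> * norm f * norm f = \<bar>Im (cinner (f' - z *\<^sub>C f) f)\<bar>"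
    by (simp add: cinner_simps cinner_self abs_mult power2_eq_square)
  also have "\<dots> \<le> cmod (cinner (f' - z *\<^sub>C f) f)" by (rule abs_Im_le_cmod)
  also have "\<dots> \<le> norm (f' - z *\<^sub>C f) * norm f" by (rule Cauchy_Schwarz_cinner)
  finally show ?thesis using False by simp
qed simp

lemma adj_sequentially_closed:
  assumes "\<And>n. (f n, f' n) \<in> adj G" "f \<longlonglongrightarrow> l" "f' \<longlonglongrightarrow> l'"
  shows "(l, l') \<in> adj G"
proof -
  have "cinner g' l = cinner g l'" if "(g, g') \<in> G" for g g'
  proof -
    have "cinner g' (f n) = cinner g (f' n)" for n
      using assms(1)[of n] that by (auto simp: adj_iff)
    then have "(\<lambda>n. cinner g' (f n)) \<longlonglongrightarrow> cinner g l'"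
      using tendsto_cinner_right[OF assms(3), of g] by simp
    with tendsto_cinner_right[OF assms(2), of g'] show ?thesis by (rule LIMSEQ_unique)
  qed
  then show ?thesis by (auto simp: adj_iff)
qed

text \<open>The range of \<open>G - z\<close> is closed by the lower bound.  A vector orthogonal to it is an eigenvector of
  the adjoint, hence of \<open>G\<close> itself, at the non-real point \<open>cnj z\<close>, which the same bound excludes.\<close>

lemma selfadjoint_surj:
  assumes sa: "selfadjoint G" and z: "Im z \<noteq> 0"
  shows "\<exists>f. (f, h + z *\<^sub>C f) \<in> G"
proof -
  have lin: "linear_op G" and adj: "adj G = G" using sa by (auto simp: selfadjoint_in_def)
  define M where "M = {h. \<exists>f. (f, h + z *\<^sub>C f) \<in> G}"
  have sub: "cvec.subspace M"
    unfolding cvec.subspace_def M_def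
  proof (intro conjI ballI allI; clarify)
    have "(0, 0 + z *\<^sub>C 0) \<in> G" using lin by (simp add: linear_op_def)
    then show "\<exists>f. (f, 0 + z *\<^sub>C f) \<in> G" by blast
  next
    fix h1 h2 f1 f2 assume "(f1, h1 + z *\<^sub>C f1) \<in> G" "(f2, h2 + z *\<^sub>C f2) \<in> G"
    from linear_op_add[OF lin this] show "\<exists>f. (f, h1 + h2 + z *\<^sub>C f) \<in> G"
      by (intro exI[of _ "f1 + f2"]) (simp add: cvec.scale_right_distrib algebra_simps)
  next
    fix c h f assume "(f, h + z *\<^sub>C f) \<in> G"
    from linear_op_scale[OF lin this, of c] show "\<exists>f. (f, c *\<^sub>C h + z *\<^sub>C f) \<in> G"
      by (intro exI[of _ "c *\<^sub>C f"]) (simp add: cvec.scale_right_distrib mult.commute)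
  qed
  have bd: "\<bar>Im w\<bar> * norm f \<le> norm (f' - w *\<^sub>C f)" if "(f, f') \<in> G" for f f' w
    using symmetric_lower_bound[of G f f' w] that adj by simp
  have "closed M"
    unfolding closed_sequential_limits
  proof (intro allI impI, elim conjE)
    fix s l assume s: "\<forall>n. s n \<in> M" "s \<longlonglongrightarrow> l"
    then obtain f where f: "\<And>n. (f n, s n + z *\<^sub>C f n) \<in> G" unfolding M_def by simp metis
    have "Cauchy f"
    proof (rule metric_CauchyI)
      fix e :: real assume e: "e > 0"
      have "Cauchy s" using s(2) by (simp add: LIMSEQ_imp_Cauchy)
      then obtain N where N: "\<And>m n. m \<ge> N \<Longrightarrow> n \<ge> N \<Longrightarrow> dist (s m) (s n) < \<bar>Im z\<bar> * e"
        using z e unfolding Cauchy_def by (metis mult_pos_pos zero_less_abs_iff)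
      have "dist (f m) (f n) < e" if "m \<ge> N" "n \<ge> N" for m n
      proof -
        have "\<bar>Im z\<bar> * norm (f m - f n) \<le> norm (s m - s n)"
          using bd[OF linear_op_diff[OF lin f f], of z m n]
          by (simp add: cvec.scale_right_diff_distrib algebra_simps)
        also have "\<dots> < \<bar>Im z\<bar> * e" using N[OF that] by (simp add: dist_norm)
        finally show ?thesis using z by (simp add: dist_norm)
      qed
      then show "\<exists>N. \<forall>m\<ge>N. \<forall>n\<ge>N. dist (f m) (f n) < e" by blast
    qed
    then obtain p where p: "f \<longlonglongrightarrow> p" using Cauchy_convergent convergent_def by blast
    have "(\<lambda>n. z *\<^sub>C f n) \<longlonglongrightarrow> z *\<^sub>C p"
    proof -
      have "(\<lambda>n. norm (z *\<^sub>C f n - z *\<^sub>C p)) \<longlonglongrightarrow> cmod z * norm (p - p)"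
        unfolding cvec.scale_right_diff_distrib[symmetric] norm_scaleC by (intro tendsto_intros p)
      then show ?thesis by (simp add: LIM_zero_iff tendsto_norm_zero_iff)
    qed
    then have "(\<lambda>n. s n + z *\<^sub>C f n) \<longlonglongrightarrow> l + z *\<^sub>C p" by (intro tendsto_add s)
    from adj_sequentially_closed[OF _ p this, of G] f adj have "(p, l + z *\<^sub>C p) \<in> G" by simp
    then show "l \<in> M" by (auto simp: M_def)
  qed
  have "h \<in> M"
  proof (rule ccontr)
    assume "h \<notin> M"
    then obtain u where u: "u \<noteq> 0" "\<And>y. y \<in> M \<Longrightarrow> cinner u y = 0"
      using closed_subspace_orthogonal_vector[OF sub \<open>closed M\<close>] by metis
    have "cinner f' u = cinner f (cnj z *\<^sub>C u)" if "(f, f') \<in> G" for f f'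
    proof -
      have "f' - z *\<^sub>C f \<in> M" using that by (auto simp: M_def intro!: exI[of _ f])
      then have "cinner (f' - z *\<^sub>C f) u = 0"
        using u(2) cinner_commute[of "f' - z *\<^sub>C f" u] by simp
      then show ?thesis by (simp add: cinner_simps)
    qed
    then have "(u, cnj z *\<^sub>C u) \<in> adj G" by (auto simp: adj_iff)
    then have "(u, cnj z *\<^sub>C u) \<in> G" by (simp only: adj)
    from bd[OF this, of "cnj z"] have "\<bar>Im z\<bar> * norm u \<le> 0" by simp
    with u(1) z show False by (simp add: mult_le_0_iff)
  qed
  then show ?thesis by (simp add: M_def)
qed

text \<open>An operator with a resolvent point is its own second adjoint.  For a resolvent point \<open>z\<close> the
  operator \<open>adj T - cnj z\<close> is onto, by Riesz representation applied to the bounded resolvent; an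
  element of the second adjoint differs from one of \<open>T\<close> by a vector orthogonal to that range.\<close>

lemma bidual_of_resolvent_nonempty:
  assumes lin: "linear_op T" and ne: "resolvent_set T \<noteq> {}"
  shows "adj (adj T) \<subseteq> T"
proof clarify
  fix f k assume fk: "(f, k) \<in> adj (adj T)"
  from ne obtain z C where ex: "\<And>h. \<exists>!f. (f, h + z *\<^sub>C f) \<in> T"
    and C: "\<And>f f'. (f, f') \<in> T \<Longrightarrow> norm f \<le> C * norm (f' - z *\<^sub>C f)"
    unfolding resolvent_set_def by blast
  define R where "R h = (THE f. (f, h + z *\<^sub>C f) \<in> T)" for h
  have R: "(R h, h + z *\<^sub>C R h) \<in> T" for h unfolding R_def by (rule theI'[OF ex])
  have R_eq: "R h = f" if "(f, h + z *\<^sub>C f) \<in> T" for h f using ex[of h] R[of h] that by auto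
  have bound: "norm (R h) \<le> C * norm h" for h using C[OF R[of h]] by simp
  have R_add: "R (h1 + h2) = R h1 + R h2" for h1 h2
    using linear_op_add[OF lin R[of h1] R[of h2]]
    by (intro R_eq) (simp add: cvec.scale_right_distrib algebra_simps)
  have R_scale: "R (c *\<^sub>C h) = c *\<^sub>C R h" for c h
    using linear_op_scale[OF lin R[of h], of c]
    by (intro R_eq) (simp add: cvec.scale_right_distrib mult.commute)
  define d where "d = f - R (k - z *\<^sub>C f)"
  define g where "g = R (k - z *\<^sub>C f)"
  have g: "(g, k - z *\<^sub>C f + z *\<^sub>C g) \<in> T" unfolding g_def by (rule R)
  have orth: "cinner d w = 0" for w
  proof -
    obtain v where v: "\<And>h. cinner (R h) w = cinner h v"
    proof (rule Riesz_representation[of "\<lambda>h. cinner (R h) w" "C * norm w"])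
      show "cmod (cinner (R h) w) \<le> C * norm w * norm h" for h
        using Cauchy_Schwarz_cinner[of "R h" w] mult_right_mono[OF bound[of h], of "norm w"]
        by (simp add: mult_ac)
    qed (auto simp: R_add R_scale cinner_simps)
    have "cinner f' v = cinner f (w + cnj z *\<^sub>C v)" if "(f, f') \<in> T" for f f'
    proof -
      have "R (f' - z *\<^sub>C f) = f" using that by (intro R_eq) simp
      with v[of "f' - z *\<^sub>C f"] show ?thesis by (simp add: cinner_simps)
    qed
    then have v': "(v, w + cnj z *\<^sub>C v) \<in> adj T" by (auto simp: adj_iff)
    with fk have "cinner (w + cnj z *\<^sub>C v) f = cinner v k" by (auto simp: adj_iff)
    then have "cinner f (w + cnj z *\<^sub>C v) = cinner k v" by (metis cinner_commute)
    moreover have "cinner (k - z *\<^sub>C f + z *\<^sub>C g) v = cinner g (w + cnj z *\<^sub>C v)"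
      using v' g by (auto simp: adj_iff)
    ultimately show ?thesis by (simp add: d_def g_def[symmetric] cinner_simps algebra_simps)
  qed
  have "d = 0" using orth[of d] by (simp add: cinner_self)
  then have "f = g" by (simp add: d_def g_def)
  then show "(f, k) \<in> T" using g by simp
qed

section \<open>The impedance function of an L-system\<close>

lemma inv_into_eqI:
  assumes "f \<in> S" "F f = y" "\<And>g. g \<in> S \<Longrightarrow> F g = y \<Longrightarrow> g = f"
  shows "inv_into S F y = f"
  unfolding inv_into_def
proof (rule some_equality)
  show "f \<in> S \<and> F f = y" using assms(1,2) by blast
  show "g = f" if "g \<in> S \<and> F g = y" for g using that assms(3) by blast
qed

locale L_sys_forms =
  fixes \<Theta> :: "'h::chilbert_space L_sys"
  assumes L_system: "L_system \<Theta>"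
begin

abbreviation "A \<equiv> sym_op \<Theta>"
abbreviation "T \<equiv> main_op \<Theta>"
abbreviation "P \<equiv> H_plus A"

text \<open>Everything is expressed by pairings.  With \<open>S\<close> for the state operator, \<open>form f g\<close> is the pairing of
  \<open>S f\<close> with \<open>g\<close>, \<open>re_form\<close> belongs to its real part, and \<open>\<kappa>\<close> is the functional \<open>K 1\<close>.\<close>

definition form :: "'h \<Rightarrow> 'h \<Rightarrow> complex" where "form f g = state_op \<Theta> f g"
definition re_form :: "'h \<Rightarrow> 'h \<Rightarrow> complex" where "re_form f g = (form f g + cnj (form g f)) / 2"
definition \<kappa> :: "'h \<Rightarrow> complex" where "\<kappa> g = channel_op \<Theta> 1 g"

abbreviation "\<A> \<equiv> quasi_kernel A (pm_Re A (state_op \<Theta>))"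

lemma linear_T: "linear_op T" and nonsym_T: "\<not> T \<subseteq> adj T"
  and resolvent_T: "resolvent_set T \<noteq> {}"
  using L_system by (auto simp: L_system_def Lambda_class_def quasi_selfadjoint_ext_def)

lemma selfadjoint_A: "selfadjoint \<A>"
  using L_system by (simp add: L_system_def star_extension_def)

lemma P_add: "f \<in> P \<Longrightarrow> g \<in> P \<Longrightarrow> f + g \<in> P"
proof -
  assume "f \<in> P" "g \<in> P"
  then obtain f' g' where "(f, f') \<in> adj A" "(g, g') \<in> adj A" by (auto simp: H_plus_def)
  then have "(f + g, f' + g') \<in> adj A" by (blast intro: adj_add adj_scale)
  then show ?thesis unfolding H_plus_def by (rule DomainI)
qed

lemma P_scale: "f \<in> P \<Longrightarrow> c *\<^sub>C f \<in> P"
proof -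
  assume "f \<in> P"
  then obtain f' where "(f, f') \<in> adj A" by (auto simp: H_plus_def)
  then have "(c *\<^sub>C f, c *\<^sub>C f') \<in> adj A" by (blast intro: adj_add adj_scale)
  then show ?thesis unfolding H_plus_def by (rule DomainI)
qed

lemma P_diff: "f \<in> P \<Longrightarrow> g \<in> P \<Longrightarrow> f - g \<in> P"
  using P_add[of f "(-1) *\<^sub>C g"] P_scale[of g "-1"] by (simp add: cvec.scale_minus_left)

lemma state_bounded: "state_op \<Theta> \<in> bounded_plus_minus A"
  and channel_bounded: "channel_op \<Theta> \<in> bounded_scalar_minus A"
  using L_system by (simp_all add: L_system_def star_extension_def)

lemma state_minus: "f \<in> P \<Longrightarrow> state_op \<Theta> f \<in> H_minus A"
  using state_bounded unfolding bounded_plus_minus_def by blast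

lemma channel_minus: "channel_op \<Theta> c \<in> H_minus A"
  using channel_bounded unfolding bounded_scalar_minus_def by blast

lemma channel_eq: "g \<in> P \<Longrightarrow> channel_op \<Theta> c g = c * \<kappa> g"
proof -
  have "channel_op \<Theta> (c * 1) = (\<lambda>h\<in>P. c * channel_op \<Theta> 1 h)"
    using channel_bounded unfolding bounded_scalar_minus_def by blast
  then show "g \<in> P \<Longrightarrow> channel_op \<Theta> c g = c * \<kappa> g" by (simp add: \<kappa>_def)
qed

lemma form_add_left:
  assumes "f \<in> P" "g \<in> P" "h \<in> P"
  shows "form (f + g) h = form f h + form g h"
proof -
  have "state_op \<Theta> (f + g) = (\<lambda>h\<in>P. state_op \<Theta> f h + state_op \<Theta> g h)"
    using state_bounded assms unfolding bounded_plus_minus_def by blast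
  then show ?thesis using assms by (simp add: form_def)
qed

lemma form_scale_left:
  assumes "f \<in> P" "h \<in> P"
  shows "form (c *\<^sub>C f) h = c * form f h"
proof -
  have "state_op \<Theta> (c *\<^sub>C f) = (\<lambda>h\<in>P. c * state_op \<Theta> f h)"
    using state_bounded assms unfolding bounded_plus_minus_def by blast
  then show ?thesis using assms by (simp add: form_def)
qed

lemma form_diff_left:
  assumes "f \<in> P" "g \<in> P" "h \<in> P"
  shows "form (f - g) h = form f h - form g h"
  using form_add_left[OF P_diff[OF assms(1,2)] assms(2,3)] by simp

lemma form_add_right: "f \<in> P \<Longrightarrow> g \<in> P \<Longrightarrow> h \<in> P \<Longrightarrow> form f (g + h) = form f g + form f h"
  and form_scale_right: "f \<in> P \<Longrightarrow> h \<in> P \<Longrightarrow> form f (c *\<^sub>C h) = cnj c * form f h"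
  using state_minus by (auto simp: H_minus_def form_def)

lemma kappa_scale: "h \<in> P \<Longrightarrow> \<kappa> (c *\<^sub>C h) = cnj c * \<kappa> h"
  using channel_minus[of 1] by (auto simp: H_minus_def \<kappa>_def)

lemma re_form_add_left: "f \<in> P \<Longrightarrow> g \<in> P \<Longrightarrow> h \<in> P \<Longrightarrow> re_form (f + g) h = re_form f h + re_form g h"
  by (simp add: re_form_def form_add_left form_add_right add_divide_distrib)

lemma re_form_diff_left:
  assumes "f \<in> P" "g \<in> P" "h \<in> P"
  shows "re_form (f - g) h = re_form f h - re_form g h"
  using re_form_add_left[OF P_diff[OF assms(1,2)] assms(2,3)] by simp

lemma re_form_scale_left: "f \<in> P \<Longrightarrow> h \<in> P \<Longrightarrow> re_form (c *\<^sub>C f) h = c * re_form f h"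
  by (simp add: re_form_def form_scale_left form_scale_right algebra_simps)

lemma re_form_commute: "re_form g f = cnj (re_form f g)"
  by (simp add: re_form_def)

lemma Im_re_form_self: "Im (re_form f f) = 0"
  by (simp add: re_form_def)

text \<open>The identity \<open>Im S = K K\<^sup>*\<close> in terms of pairings: the imaginary part of the form has rank one.\<close>

lemma form_eq_re_form:
  assumes f: "f \<in> P" and g: "g \<in> P"
  shows "form f g = re_form f g + \<i> * cnj (\<kappa> f) * \<kappa> g"
proof -
  have "pm_Im A (state_op \<Theta>) f = channel_op \<Theta> (K_adj (channel_op \<Theta>) f)"
    using L_system f by (simp add: L_system_def)
  then have "pm_Im A (state_op \<Theta>) f g = channel_op \<Theta> (cnj (\<kappa> f)) g"
    by (simp add: K_adj_def \<kappa>_def)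
  then have "(form f g - cnj (form g f)) / (2 * \<i>) = cnj (\<kappa> f) * \<kappa> g"
    unfolding channel_eq[OF g] using g by (simp add: pm_Im_def pm_adj_def form_def)
  then have "form f g - cnj (form g f) = 2 * \<i> * (cnj (\<kappa> f) * \<kappa> g)"
    by (simp add: field_simps)
  then have *: "cnj (form g f) = form f g - 2 * \<i> * (cnj (\<kappa> f) * \<kappa> g)" by algebra
  show ?thesis unfolding re_form_def * by (simp add: field_simps)
qed

lemma T_form:
  assumes "(f, f') \<in> T"
  shows "f \<in> P" and "g \<in> P \<Longrightarrow> form f g = cinner f' g"
proof -
  have "pm_extends A (state_op \<Theta>) T"
    using L_system by (simp add: L_system_def star_extension_def)
  then have *: "f \<in> P \<and> state_op \<Theta> f = emb A f'" using assms by (auto simp: pm_extends_def)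
  then show "f \<in> P" by simp
  show "form f g = cinner f' g" if "g \<in> P" using * that by (simp add: form_def emb_def)
qed

lemma adj_T_form:
  assumes "(v, v') \<in> adj T"
  shows "v \<in> P" and "g \<in> P \<Longrightarrow> cnj (form g v) = cinner v' g"
proof -
  have "pm_extends A (pm_adj A (state_op \<Theta>)) (adj T)"
    using L_system by (simp add: L_system_def star_extension_def)
  then have *: "v \<in> P \<and> pm_adj A (state_op \<Theta>) v = emb A v'" using assms by (auto simp: pm_extends_def)
  then show "v \<in> P" by simp
  have "pm_adj A (state_op \<Theta>) v g = emb A v' g" using * by simp
  then show "cnj (form g v) = cinner v' g" if "g \<in> P" using that by (simp add: form_def emb_def pm_adj_def)
qed

lemma quasi_kernel_iff: "(f, h) \<in> \<A> \<longleftrightarrow> f \<in> P \<and> (\<forall>g\<in>P. re_form f g = cinner h g)"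
  by (auto simp: quasi_kernel_def re_form_def pm_Re_def pm_adj_def form_def emb_def fun_eq_iff restrict_def)

lemma pm_shift_Re_iff:
  "f \<in> P \<Longrightarrow> pm_shift A (pm_Re A (state_op \<Theta>)) z f = channel_op \<Theta> 1 \<longleftrightarrow>
     (\<forall>g\<in>P. re_form f g - z * cinner f g = \<kappa> g)"
  using channel_minus[of 1]
  by (auto simp: pm_shift_def re_form_def pm_Re_def pm_adj_def form_def emb_def fun_eq_iff restrict_def
      \<kappa>_def H_minus_def extensional_def)

lemma pm_shift_iff:
  "f \<in> P \<Longrightarrow> pm_shift A (state_op \<Theta>) z f = channel_op \<Theta> 1 \<longleftrightarrow>
     (\<forall>g\<in>P. form f g - z * cinner f g = \<kappa> g)"
  using channel_minus[of 1]
  by (auto simp: pm_shift_def form_def emb_def fun_eq_iff restrict_def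
      \<kappa>_def H_minus_def extensional_def)

text \<open>A solution of \<open>(Re S) f = z f\<close> belongs to the quasi-kernel, whose eigenvalues are real.\<close>

lemma re_form_kernel_trivial:
  assumes f: "f \<in> P" and z: "Im z \<noteq> 0" and eq: "\<And>g. g \<in> P \<Longrightarrow> re_form f g = z * cinner f g"
  shows "f = 0"
proof -
  have "(f, z *\<^sub>C f) \<in> \<A>" using f eq by (simp add: quasi_kernel_iff cinner_simps)
  moreover have "\<A> \<subseteq> adj \<A>" using selfadjoint_A by (simp add: selfadjoint_in_def)
  ultimately have "\<bar>Im z\<bar> * norm f \<le> norm (z *\<^sub>C f - z *\<^sub>C f)"
    by (intro symmetric_lower_bound)
  with z show ?thesis by (simp add: mult_le_0_iff)
qed

lemma resolvent_A:
  assumes "Im z \<noteq> 0"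
  obtains u where "u \<in> P" "\<And>g. g \<in> P \<Longrightarrow> re_form u g - z * cinner u g = cinner h g"
proof -
  obtain u where "(u, h + z *\<^sub>C u) \<in> \<A>" using selfadjoint_surj[OF selfadjoint_A assms] by blast
  then show thesis using that[of u] by (simp add: quasi_kernel_iff cinner_simps)
qed

text \<open>Where \<open>\<kappa>\<close> vanishes the form agrees with its Hermitian part; if this happened on all of \<open>T\<close>, then
  \<open>T\<close> would be symmetric.\<close>

lemma kappa_nonzero_on_T: "\<exists>(f, f') \<in> T. \<kappa> f \<noteq> 0"
proof (rule ccontr)
  assume "\<not> ?thesis"
  then have k0: "\<kappa> f = 0" if "(f, f') \<in> T" for f f' using that by auto
  have "(f, f') \<in> adj T" if f: "(f, f') \<in> T" for f f'
  proof -
    have "cinner g' f = cinner g f'" if g: "(g, g') \<in> T" for g g'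
    proof -
      have P: "f \<in> P" "g \<in> P" using f g T_form by auto
      have "cinner g' f = re_form g f" using T_form(2)[OF g P(1)] form_eq_re_form[OF P(2,1)] k0[OF f] by simp
      also have "\<dots> = cnj (re_form f g)" by (rule re_form_commute)
      also have "re_form f g = cinner f' g" using T_form(2)[OF f P(2)] form_eq_re_form[OF P] k0[OF f] by simp
      finally show ?thesis using cinner_commute[of g f'] by simp
    qed
    then show ?thesis by (auto simp: adj_iff)
  qed
  then show False using nonsym_T by auto
qed

text \<open>If \<open>f\<close> belongs to the domain of \<open>T\<close>, then \<open>(Re S - z) f\<close> equals \<open>(T - z) f - i cnj (\<kappa> f) K 1\<close>.  The
  first summand is an ordinary vector, so it is also \<open>(Re S - z) u\<close> for some \<open>u\<close> in the domain of the
  quasi-kernel.  Hence \<open>f - u\<close> is mapped to a multiple of \<open>K 1\<close>, and the multiple is not zero for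
  a suitable \<open>f\<close>.\<close>

lemma ex1_impedance_vector:
  assumes z: "Im z \<noteq> 0"
  shows "\<exists>!f. f \<in> P \<and> (\<forall>g\<in>P. re_form f g - z * cinner f g = \<kappa> g)"
proof -
  obtain f f' where ff: "(f, f') \<in> T" and k: "\<kappa> f \<noteq> 0" using kappa_nonzero_on_T by blast
  have f: "f \<in> P" using T_form[OF ff] by simp
  obtain u where u: "u \<in> P" "\<And>g. g \<in> P \<Longrightarrow> re_form u g - z * cinner u g = cinner (f' - z *\<^sub>C f) g"
    using resolvent_A[OF z, of "f' - z *\<^sub>C f"] by blast
  \<comment> \<open>Chosen such that \<open>c\<close> times \<open>- i cnj (\<kappa> f)\<close> is \<open>1\<close>.\<close>
  define c where "c = \<i> / cnj (\<kappa> f)"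
  have c: "c * (\<i> * cnj (\<kappa> f)) = -1" using k by (simp add: c_def)
  define w where "w = c *\<^sub>C f - c *\<^sub>C u"
  have w: "w \<in> P" unfolding w_def by (intro P_diff P_scale f u)
  have w_eq: "re_form w g - z * cinner w g = \<kappa> g" if g: "g \<in> P" for g
  proof -
    define k where "k = \<i> * cnj (\<kappa> f)"
    have "re_form w g - z * cinner w g = c * (re_form f g - z * cinner f g) - c * (re_form u g - z * cinner u g)"
      unfolding w_def using f u(1) g
      by (simp add: re_form_diff_left re_form_scale_left P_scale cinner_simps right_diff_distrib mult.left_commute)
    also have "re_form f g = cinner f' g - k * \<kappa> g"
      unfolding k_def using T_form(2)[OF ff g] form_eq_re_form[OF f g] by (simp add: eq_diff_eq)
    also have "re_form u g - z * cinner u g = cinner f' g - z * cinner f g"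
      using u(2)[OF g] by (simp only: cinner_simps)
    also have "c * (cinner f' g - k * \<kappa> g - z * cinner f g) - c * (cinner f' g - z * cinner f g)
        = - (c * k) * \<kappa> g"
      by (simp add: algebra_simps)
    also have "c * k = -1" unfolding k_def by (rule c)
    finally show ?thesis by simp
  qed
  show ?thesis
  proof (rule ex1I[of _ w])
    show "w \<in> P \<and> (\<forall>g\<in>P. re_form w g - z * cinner w g = \<kappa> g)" using w w_eq by simp
  next
    fix w' assume w': "w' \<in> P \<and> (\<forall>g\<in>P. re_form w' g - z * cinner w' g = \<kappa> g)"
    have "w' - w = 0"
    proof (rule re_form_kernel_trivial[OF _ z])
      fix g assume g: "g \<in> P"
      have "re_form w' g - z * cinner w' g = re_form w g - z * cinner w g"
        using w' w_eq g by simp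
      then have "re_form w' g - re_form w g = z * (cinner w' g - cinner w g)"
        by (simp add: diff_eq_eq right_diff_distrib)
      then show "re_form (w' - w) g = z * cinner (w' - w) g"
        using w w' g by (simp add: re_form_diff_left cinner_simps)
    qed (use w w' P_diff in blast)
    then show "w' = w" by simp
  qed
qed

text \<open>The unique solution \<open>f\<close> of \<open>(Re S - z) f = K 1\<close>.\<close>

definition channel_resolvent :: "complex \<Rightarrow> 'h" where
  "channel_resolvent z = (THE f. f \<in> P \<and> (\<forall>g\<in>P. re_form f g - z * cinner f g = \<kappa> g))"

definition V :: "complex \<Rightarrow> complex" where "V z = cnj (\<kappa> (channel_resolvent z))"

lemma channel_resolvent:
  assumes "Im z \<noteq> 0"
  shows "channel_resolvent z \<in> P" and "g \<in> P \<Longrightarrow> re_form (channel_resolvent z) g - z * cinner (channel_resolvent z) g = \<kappa> g"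
proof -
  have "channel_resolvent z \<in> P \<and> (\<forall>g\<in>P. re_form (channel_resolvent z) g - z * cinner (channel_resolvent z) g = \<kappa> g)"
    unfolding channel_resolvent_def by (rule theI'[OF ex1_impedance_vector[OF assms]])
  then show "channel_resolvent z \<in> P" and "g \<in> P \<Longrightarrow> re_form (channel_resolvent z) g - z * cinner (channel_resolvent z) g = \<kappa> g" by simp_all
qed

lemma channel_resolvent_unique:
  assumes "Im z \<noteq> 0" "f \<in> P" "\<And>g. g \<in> P \<Longrightarrow> re_form f g - z * cinner f g = \<kappa> g"
  shows "f = channel_resolvent z"
  unfolding channel_resolvent_def by (rule the1_equality[OF ex1_impedance_vector[OF assms(1)], symmetric])
    (simp add: assms(2,3))

lemma impedance_fun_eq_V:
  assumes z: "Im z \<noteq> 0"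
  shows "impedance_fun \<Theta> z = V z"
proof -
  have "pm_inverse A (pm_shift A (pm_Re A (state_op \<Theta>)) z) (channel_op \<Theta> 1) = channel_resolvent z"
    unfolding pm_inverse_def
  proof (rule inv_into_eqI)
    show "channel_resolvent z \<in> P" by (rule channel_resolvent(1)[OF z])
    then show "pm_shift A (pm_Re A (state_op \<Theta>)) z (channel_resolvent z) = channel_op \<Theta> 1"
      using channel_resolvent(2)[OF z] by (simp add: pm_shift_Re_iff)
    show "g = channel_resolvent z" if "g \<in> P" "pm_shift A (pm_Re A (state_op \<Theta>)) z g = channel_op \<Theta> 1" for g
      using that by (intro channel_resolvent_unique[OF z]) (simp_all add: pm_shift_Re_iff)
  qed
  then show ?thesis by (simp add: impedance_fun_def V_def K_adj_def \<kappa>_def)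
qed

lemma Im_V:
  assumes z: "Im z \<noteq> 0"
  shows "Im (V z) = Im z * (norm (channel_resolvent z))\<^sup>2"
proof -
  have "Im (re_form (channel_resolvent z) (channel_resolvent z) - z * cinner (channel_resolvent z) (channel_resolvent z)) = Im (\<kappa> (channel_resolvent z))"
    by (rule arg_cong[OF channel_resolvent(2)[OF z channel_resolvent(1)[OF z]]])
  then show ?thesis by (simp add: V_def cinner_self Im_re_form_self del: of_real_power)
qed

text \<open>For the vectors \<open>f\<close> and \<open>g\<close> belonging to \<open>z\<close> and \<open>cnj z\<close>, the pairing of \<open>(Re S - z) f\<close> with \<open>g\<close> is
  \<open>cnj (V (cnj z))\<close>; as the form is Hermitian, it is also the conjugate of the pairing of
  \<open>(Re S - cnj z) g\<close> with \<open>f\<close>, which is \<open>V z\<close>.\<close>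

lemma V_cnj:
  assumes z: "Im z \<noteq> 0"
  shows "V (cnj z) = cnj (V z)"
proof -
  have z': "Im (cnj z) \<noteq> 0" using z by simp
  have "cnj (V (cnj z)) = re_form (channel_resolvent z) (channel_resolvent (cnj z)) - z * cinner (channel_resolvent z) (channel_resolvent (cnj z))"
    unfolding V_def complex_cnj_cnj by (rule channel_resolvent(2)[OF z channel_resolvent(1)[OF z'], symmetric])
  also have "\<dots> = cnj (re_form (channel_resolvent (cnj z)) (channel_resolvent z) - cnj z * cinner (channel_resolvent (cnj z)) (channel_resolvent z))"
    unfolding complex_cnj_diff complex_cnj_mult complex_cnj_cnj
      re_form_commute[of "channel_resolvent z" "channel_resolvent (cnj z)", symmetric] cinner_commute[of "channel_resolvent z" "channel_resolvent (cnj z)", symmetric] ..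
  also have "\<dots> = V z" unfolding V_def channel_resolvent(2)[OF z' channel_resolvent(1)[OF z]] ..
  finally show ?thesis by (metis complex_cnj_cnj)
qed

text \<open>The vectors that the state operator maps into the Hilbert space are exactly those of the domain of
  \<open>T\<close>: such a pair belongs to the second adjoint of \<open>T\<close>, because the adjoint form extends \<open>adj T\<close>.\<close>

lemma form_range_maximal:
  assumes f: "f \<in> P" and h: "\<And>g. g \<in> P \<Longrightarrow> form f g = cinner h g"
  shows "(f, h) \<in> T"
proof -
  have "cinner v' f = cinner v h" if v: "(v, v') \<in> adj T" for v v'
    using adj_T_form(2)[OF v f] h[OF adj_T_form(1)[OF v]] cinner_commute[of v h] by simp
  then have "(f, h) \<in> adj (adj T)" by (auto simp: adj_iff)
  then show ?thesis using bidual_of_resolvent_nonempty[OF linear_T resolvent_T] by blast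
qed

text \<open>The imaginary part of the form of \<open>T\<close> is \<open>|\<kappa> f|\<^sup>2 \<ge> 0\<close>, so in the lower half-plane it adds to the
  contribution of \<open>- z\<close> instead of cancelling it.\<close>

lemma T_lower_bound:
  assumes f: "(f, f') \<in> T" and z: "Im z < 0"
  shows "\<bar>Im z\<bar> * norm f \<le> norm (f' - z *\<^sub>C f)"
proof (cases "f = 0")
  case False
  have P: "f \<in> P" using T_form[OF f] by simp
  have "cinner f' f = re_form f f + \<i> * complex_of_real ((cmod (\<kappa> f))\<^sup>2)"
    using T_form(2)[OF f P] form_eq_re_form[OF P P] by (simp add: complex_norm_square mult_ac del: of_real_power)
  then have "Im (cinner f' f) \<ge> 0" by (simp add: Im_re_form_self del: of_real_power)
  then have "\<bar>Im z\<bar> * norm f * norm f \<le> Im (cinner (f' - z *\<^sub>C f) f)"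
    using z by (simp add: cinner_simps cinner_self power2_eq_square)
  also have "\<dots> \<le> cmod (cinner (f' - z *\<^sub>C f) f)" using abs_Im_le_cmod[of "cinner (f' - z *\<^sub>C f) f"] by linarith
  also have "\<dots> \<le> norm (f' - z *\<^sub>C f) * norm f" by (rule Cauchy_Schwarz_cinner)
  finally show ?thesis using False by simp
qed simp

text \<open>In the lower half-plane \<open>V\<close> does not take values in the upper one, in particular not the value \<open>i\<close>.\<close>

lemma one_plus_iV_nonzero:
  assumes z: "Im z < 0"
  shows "1 + \<i> * V z \<noteq> 0"
proof
  assume "1 + \<i> * V z = 0"
  then have "Im (V z) = 1" by (simp add: complex_eq_iff)
  moreover have "Im (V z) \<le> 0" using Im_V[of z] z by (simp add: mult_nonpos_nonneg)
  ultimately show False by simp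
qed

lemma form_channel_resolvent:
  assumes z: "Im z \<noteq> 0" and g: "g \<in> P"
  shows "form (channel_resolvent z) g - z * cinner (channel_resolvent z) g = (1 + \<i> * V z) * \<kappa> g"
  using channel_resolvent(2)[OF z g] form_eq_re_form[OF channel_resolvent(1)[OF z] g] by (simp add: V_def algebra_simps)

text \<open>The resolvent of \<open>T\<close> is a rank-one perturbation of that of the quasi-kernel, with denominator
  \<open>1 + i V z\<close>.\<close>

lemma lower_half_plane_resolvent:
  assumes z: "Im z < 0"
  shows "z \<in> resolvent_set T"
proof -
  have z': "Im z \<noteq> 0" using z by simp
  have "\<exists>f. (f, h + z *\<^sub>C f) \<in> T" for h
  proof -
    obtain u where u: "u \<in> P" "\<And>g. g \<in> P \<Longrightarrow> re_form u g - z * cinner u g = cinner h g"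
      using resolvent_A[OF z', of h] by blast
    \<comment> \<open>\<open>(S - z) u\<close> exceeds \<open>h\<close> by \<open>i cnj (\<kappa> u) K 1\<close>, which a multiple of \<open>channel_resolvent z\<close> removes.\<close>
    define c where "c = \<i> * cnj (\<kappa> u) / (1 + \<i> * V z)"
    have c: "c * (1 + \<i> * V z) = \<i> * cnj (\<kappa> u)"
      using one_plus_iV_nonzero[OF z] by (simp add: c_def)
    define f where "f = u - c *\<^sub>C channel_resolvent z"
    have f: "f \<in> P" unfolding f_def by (intro P_diff P_scale u channel_resolvent z')
    have "form f g = cinner (h + z *\<^sub>C f) g" if g: "g \<in> P" for g
    proof -
      have "form f g - z * cinner f g
          = (form u g - z * cinner u g) - c * (form (channel_resolvent z) g - z * cinner (channel_resolvent z) g)"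
        unfolding f_def using u(1) g channel_resolvent(1)[OF z']
        by (simp add: form_diff_left form_scale_left P_scale cinner_simps right_diff_distrib mult.left_commute)
      also have "form u g - z * cinner u g = cinner h g + \<i> * cnj (\<kappa> u) * \<kappa> g"
        using u(2)[OF g] form_eq_re_form[OF u(1) g] by (simp add: algebra_simps)
      also have "c * (form (channel_resolvent z) g - z * cinner (channel_resolvent z) g) = \<i> * cnj (\<kappa> u) * \<kappa> g"
        unfolding form_channel_resolvent[OF z' g] c[symmetric] by (simp add: mult.assoc)
      finally show ?thesis by (simp add: cinner_simps algebra_simps)
    qed
    with f show ?thesis using form_range_maximal by blast
  qed
  moreover have "f1 = f2" if "(f1, h + z *\<^sub>C f1) \<in> T" "(f2, h + z *\<^sub>C f2) \<in> T" for f1 f2 h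
  proof -
    have "\<bar>Im z\<bar> * norm (f1 - f2) \<le> norm (h + z *\<^sub>C f1 - (h + z *\<^sub>C f2) - z *\<^sub>C (f1 - f2))"
      by (rule T_lower_bound[OF linear_op_diff[OF linear_T that] z])
    then have "\<bar>Im z\<bar> * norm (f1 - f2) \<le> 0"
      by (simp add: cvec.scale_right_diff_distrib)
    then show ?thesis using z' by (simp add: mult_le_0_iff)
  qed
  moreover have "norm f \<le> (1 / \<bar>Im z\<bar>) * norm (f' - z *\<^sub>C f)" if "(f, f') \<in> T" for f f'
    using T_lower_bound[OF that z] z' by (simp add: field_simps)
  ultimately show ?thesis unfolding resolvent_set_def by blast
qed

text \<open>Since \<open>S - z\<close> maps \<open>channel_resolvent z\<close> to \<open>(1 + i V z) K 1\<close>, division by this scalar solves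
  \<open>(S - z) f = K 1\<close>.\<close>

lemma transfer_fun_eq:
  assumes z: "Im z < 0"
  shows "transfer_fun \<Theta> z = (1 - \<i> * V z) / (1 + \<i> * V z)"
proof -
  have z': "Im z \<noteq> 0" using z by simp
  note nz = one_plus_iV_nonzero[OF z]
  define f where "f = (1 / (1 + \<i> * V z)) *\<^sub>C channel_resolvent z"
  have f: "f \<in> P" unfolding f_def by (intro P_scale channel_resolvent z')
  have f_eq: "form f g - z * cinner f g = \<kappa> g" if "g \<in> P" for g
  proof -
    have "form f g - z * cinner f g = (1 / (1 + \<i> * V z)) * (form (channel_resolvent z) g - z * cinner (channel_resolvent z) g)"
      unfolding f_def using channel_resolvent(1)[OF z'] that
      by (simp add: form_scale_left cinner_simps right_diff_distrib mult.left_commute diff_divide_distrib)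
    then show ?thesis using nz by (simp add: form_channel_resolvent[OF z' that])
  qed
  have "pm_inverse A (pm_shift A (state_op \<Theta>) z) (channel_op \<Theta> 1) = f"
    unfolding pm_inverse_def
  proof (rule inv_into_eqI)
    show "pm_shift A (state_op \<Theta>) z f = channel_op \<Theta> 1" using f f_eq by (simp add: pm_shift_iff)
    fix w assume w: "w \<in> P" "pm_shift A (state_op \<Theta>) z w = channel_op \<Theta> 1"
    then have w_eq: "form w g = z * cinner w g + \<kappa> g" if "g \<in> P" for g
      using that by (simp add: pm_shift_iff algebra_simps)
    have "w - f \<in> P" using w f by (simp add: P_diff)
    moreover have "form (w - f) g = cinner (z *\<^sub>C (w - f)) g" if g: "g \<in> P" for g
    proof -
      have "form w g - z * cinner w g = form f g - z * cinner f g"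
        using w_eq[OF g] f_eq[OF g] by simp
      then have "form w g - form f g = z * (cinner w g - cinner f g)"
        by (simp add: diff_eq_eq right_diff_distrib)
      then show ?thesis using w(1) f g by (simp add: form_diff_left cinner_simps)
    qed
    ultimately have "(w - f, z *\<^sub>C (w - f)) \<in> T" by (rule form_range_maximal)
    from T_lower_bound[OF this z] z show "w = f" by (simp add: zero_le_mult_iff)
  qed (fact f)
  then have "transfer_fun \<Theta> z = 1 - 2 * \<i> * cnj (\<kappa> f)"
    by (simp add: transfer_fun_def K_adj_def \<kappa>_def)
  also have "cnj (\<kappa> f) = V z / (1 + \<i> * V z)"
    unfolding f_def using channel_resolvent(1)[OF z'] by (simp add: kappa_scale V_def)
  also have "1 - 2 * \<i> * (V z / (1 + \<i> * V z)) = (1 - \<i> * V z) / (1 + \<i> * V z)"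
    using nz by (simp add: field_simps)
  finally show ?thesis .
qed

end

section \<open>The impedance function of a unimodular transformation\<close>

text \<open>Multiplying the hypothesis by \<open>exp (- i\<alpha>)\<close> makes it symmetric, and its expansion is
  \<open>cos \<alpha> (1 + p q) + sin \<alpha> (q - p) = 0\<close>; this is divided by \<open>cos \<alpha>\<close> and the left side completed to
  a product.\<close>

lemma cayley_rotation:
  fixes p q :: complex
  assumes p: "1 + \<i> * p \<noteq> 0" and q: "1 + \<i> * q \<noteq> 0" and c: "cos \<alpha> \<noteq> 0"
    and eq: "(1 - \<i> * p) / (1 + \<i> * p) =
      (1 - \<i> * q) / (1 + \<i> * q) * (- exp (2 * \<i> * complex_of_real \<alpha>))"
  shows "(p + of_real (tan \<alpha>)) * (q - of_real (tan \<alpha>)) = - of_real (1 + (tan \<alpha>)\<^sup>2)"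
proof -
  define e where "e = exp (\<i> * complex_of_real \<alpha>)"
  define C S where "C = complex_of_real (cos \<alpha>)" and "S = complex_of_real (sin \<alpha>)"
  have e0: "e \<noteq> 0" and ee: "exp (2 * \<i> * complex_of_real \<alpha>) = e * e"
    by (simp_all add: e_def exp_add[symmetric] mult_ac)
  have e1: "e = C + \<i> * S"
    by (simp add: e_def exp_Euler C_def S_def cos_of_real sin_of_real)
  have CS: "C\<^sup>2 + S\<^sup>2 = 1"
    by (metis C_def S_def add.commute of_real_1 of_real_add of_real_power sin_cos_squared_add)
  have inv: "(C - \<i> * S) * e = 1"
    unfolding e1 using CS by (simp add: algebra_simps power2_eq_square)
  have "(1 - \<i> * p) * (1 + \<i> * q) = - (e * e) * ((1 - \<i> * q) * (1 + \<i> * p))"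
    using eq p q unfolding ee by (simp add: field_simps)
  then have "(C - \<i> * S) * ((1 - \<i> * p) * (1 + \<i> * q))
      = - ((C - \<i> * S) * e) * e * ((1 - \<i> * q) * (1 + \<i> * p))"
    by (simp add: mult_ac)
  then have "(C - \<i> * S) * ((1 - \<i> * p) * (1 + \<i> * q))
      = - (C + \<i> * S) * ((1 - \<i> * q) * (1 + \<i> * p))"
    by (simp only: inv) (simp add: e1)
  then have "2 * (C * (1 + p * q) + S * (q - p)) = 0"
    by (simp add: algebra_simps)
  then have *: "C * (1 + p * q) + S * (q - p) = 0" by (simp only: mult_eq_0_iff) simp
  define t where "t = complex_of_real (tan \<alpha>)"
  have S: "S = t * C" using c by (simp add: S_def C_def t_def tan_def)
  have "C * ((1 + p * q) + t * (q - p)) = 0" using * by (simp add: S algebra_simps)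
  then have "1 + p * q + t * (q - p) = 0" using c by (simp add: C_def)
  then show ?thesis unfolding t_def[symmetric] of_real_add of_real_power
    by (simp add: algebra_simps power2_eq_square)
qed

text \<open>The defining identity of the transformation holds wherever both main operators have a resolvent, so
  it is available at \<open>cnj z\<close>; conjugation brings it to \<open>z\<close>.\<close>

theorem unimodular_impedance_relation:
  assumes \<Theta>: "L_system \<Theta>" and uni: "unimodular_transformation \<alpha> \<Theta> \<Theta>'" and c: "cos \<alpha> \<noteq> 0"
    and z: "Im z > 0"
  shows "(impedance_fun \<Theta>' z + of_real (tan \<alpha>)) * (impedance_fun \<Theta> z - of_real (tan \<alpha>))
    = - of_real (1 + (tan \<alpha>)\<^sup>2)"
proof -
  have \<Theta>': "L_system \<Theta>'" using uni by (simp add: unimodular_transformation_def)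
  interpret a: L_sys_forms \<Theta> by unfold_locales (rule \<Theta>)
  interpret b: L_sys_forms \<Theta>' by unfold_locales (rule \<Theta>')
  have z0: "Im z \<noteq> 0" and z': "Im (cnj z) < 0" using z by auto
  have "transfer_fun \<Theta>' (cnj z) = transfer_fun \<Theta> (cnj z) * (- exp (2 * \<i> * complex_of_real \<alpha>))"
    using uni a.lower_half_plane_resolvent[OF z'] b.lower_half_plane_resolvent[OF z']
    unfolding unimodular_transformation_def by blast
  then have "(b.V (cnj z) + of_real (tan \<alpha>)) * (a.V (cnj z) - of_real (tan \<alpha>))
      = - of_real (1 + (tan \<alpha>)\<^sup>2)"
    unfolding a.transfer_fun_eq[OF z'] b.transfer_fun_eq[OF z']
    by (intro cayley_rotation a.one_plus_iV_nonzero b.one_plus_iV_nonzero z' c)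
  then have "cnj ((b.V z + of_real (tan \<alpha>)) * (a.V z - of_real (tan \<alpha>)))
      = cnj (- of_real (1 + (tan \<alpha>)\<^sup>2))"
    by (simp add: a.V_cnj[OF z0] b.V_cnj[OF z0])
  then show ?thesis
    unfolding complex_cnj_cancel_iff by (simp add: a.impedance_fun_eq_V[OF z0] b.impedance_fun_eq_V[OF z0])
qed

section \<open>The Herglotz representation on the disc\<close>

abbreviation circ :: "real \<Rightarrow> complex" where "circ x \<equiv> cis (2 * pi * x)"

lemma circ_cnj: "cnj (circ x) = 1 / circ x"
  by (simp add: cis_cnj divide_inverse)

lemma circ_minus_nonzero: "cmod w < 1 \<Longrightarrow> circ x - w \<noteq> 0"
  by auto

lemma has_contour_integral_unit_circle:
  "(f has_contour_integral I) (circlepath 0 1) \<longleftrightarrow>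
     ((\<lambda>x. 2 * of_real pi * \<i> * (f (circ x) * circ x)) has_integral I) {0..1}"
proof -
  have "circlepath 0 1 x = circ x" for x
    by (simp add: circlepath cis_conv_exp mult_ac)
  moreover have "vector_derivative (circlepath 0 1) (at x) = 2 * of_real pi * \<i> * circ x" for x
    unfolding vector_derivative_circlepath by (simp add: cis_conv_exp mult_ac)
  ultimately show ?thesis by (simp add: has_contour_integral mult_ac)
qed

lemma has_integral_unit_circle_cancel:
  assumes "((\<lambda>x. 2 * of_real pi * \<i> * f x) has_integral (2 * of_real pi * \<i> * c)) {0..1::real}"
  shows "(f has_integral c) {0..1}"
proof -
  have "(2 * of_real pi * \<i> :: complex) \<noteq> 0" by simp
  with has_integral_mult_right[OF assms, of "1 / (2 * of_real pi * \<i>)"] show ?thesis by simp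
qed

text \<open>An analytic function is recovered from its real part on the circle.  The Cauchy formula represents
  \<open>h w\<close>; the Cauchy integral at the point reflected in the circle vanishes, and its conjugate brings
  in the values \<open>cnj h\<close>; adding the two leaves \<open>2 Re h\<close>, up to the mean value \<open>h 0\<close>.\<close>

theorem Schwarz_integral_formula:
  assumes h: "h holomorphic_on ball 0 R" and R: "R > 1" and w: "cmod w < 1"
  shows "((\<lambda>x. (circ x + w) / (circ x - w) * of_real (Re (h (circ x)))) has_integral
           (h w - \<i> * of_real (Im (h 0)))) {0..1}"
proof -
  have sub: "cball 0 1 \<subseteq> ball (0::complex) R" using R by auto
  have hc: "h holomorphic_on cball 0 1" by (rule holomorphic_on_subset[OF h sub])
  have cauchy: "((\<lambda>x. h (circ x) * circ x / (circ x - v)) has_integral h v) {0..1}"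
    if "cmod v < 1" for v
  proof -
    have "((\<lambda>u. h u / (u - v)) has_contour_integral (2 * of_real pi * \<i> * h v)) (circlepath 0 1)"
      using that by (intro Cauchy_integral_circlepath_simple hc) simp
    from has_integral_unit_circle_cancel[OF this[unfolded has_contour_integral_unit_circle]]
    show ?thesis by simp
  qed
  \<comment> \<open>A radius above \<open>1\<close> for which the disc does not contain the reflection of \<open>w\<close>.\<close>
  define \<rho> where "\<rho> = min R (2 / (1 + cmod w))"
  have w1: "0 < 1 + cmod w" by (smt (verit) norm_ge_zero)
  have \<rho>: "1 < \<rho>" "\<rho> \<le> R" using R w w1 by (auto simp: \<rho>_def field_simps)
  have \<rho>w: "cmod w * \<rho> < 1"
  proof -
    have "cmod w * \<rho> \<le> cmod w * (2 / (1 + cmod w))" unfolding \<rho>_def by (intro mult_left_mono) auto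
    also have "\<dots> < 1" using w w1 by (simp add: field_simps)
    finally show ?thesis .
  qed
  have nz: "cnj w * u - 1 \<noteq> 0" if "u \<in> ball 0 \<rho>" for u
  proof
    assume "cnj w * u - 1 = 0"
    then have "cmod w * cmod u = 1" by (metis complex_mod_cnj eq_iff_diff_eq_0 norm_mult norm_one)
    moreover have "cmod w * cmod u \<le> cmod w * \<rho>" using that by (intro mult_left_mono) auto
    ultimately show False using \<rho>w by simp
  qed
  have "(\<lambda>u. h u * cnj w / (cnj w * u - 1)) holomorphic_on ball 0 \<rho>"
    using nz by (intro holomorphic_intros holomorphic_on_subset[OF h]) (use \<rho> in auto)
  then have "((\<lambda>u. h u * cnj w / (cnj w * u - 1)) has_contour_integral 0) (circlepath 0 1)"
    by (rule Cauchy_theorem_disc_simple) (use \<rho> in auto)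
  then have "((\<lambda>x. 2 * of_real pi * \<i> * (h (circ x) * cnj w / (cnj w * circ x - 1) * circ x))
      has_integral 2 * of_real pi * \<i> * 0) {0..1}"
    unfolding has_contour_integral_unit_circle by simp
  note has_integral_linear[OF has_integral_unit_circle_cancel[OF this] bounded_linear_cnj, unfolded complex_cnj_zero]
  then have refl: "((\<lambda>x. cnj (h (circ x)) * w / (w - circ x)) has_integral 0) {0..1}"
  proof (rule has_integral_eq[rotated])
    fix x
    have "cnj (h (circ x) * cnj w / (cnj w * circ x - 1) * circ x)
        = cnj (h (circ x)) * w / ((w * cnj (circ x) - 1) * circ x)"
      by (simp add: circ_cnj)
    also have "(w * cnj (circ x) - 1) * circ x = w - circ x"
      by (simp add: circ_cnj left_diff_distrib)
    finally show "(cnj \<circ> (\<lambda>x. h (circ x) * cnj w / (cnj w * circ x - 1) * circ x)) x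
        = cnj (h (circ x)) * w / (w - circ x)" by (simp add: o_def)
  qed
  have h0: "((\<lambda>x. h (circ x)) has_integral h 0) {0..1}"
    using cauchy[of 0] by simp
  have h0': "((\<lambda>x. cnj (h (circ x))) has_integral cnj (h 0)) {0..1}"
    using has_integral_linear[OF h0 bounded_linear_cnj] by (simp add: o_def)
  have "((\<lambda>x. h (circ x) * circ x / (circ x - w) - (h (circ x) - cnj (h (circ x))) / 2
      - cnj (h (circ x)) * w / (w - circ x)) has_integral (h w - (h 0 - cnj (h 0)) / 2 - 0)) {0..1}"
    by (intro has_integral_diff has_integral_divide cauchy w h0 h0' refl)
  moreover have "h w - (h 0 - cnj (h 0)) / 2 - 0 = h w - \<i> * of_real (Im (h 0))"
    by (simp add: complex_eq_iff)
  moreover have "h (circ x) * circ x / (circ x - w) - (h (circ x) - cnj (h (circ x))) / 2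
      - cnj (h (circ x)) * w / (w - circ x)
      = (circ x + w) / (circ x - w) * of_real (Re (h (circ x)))" for x
  proof -
    define a D where "a = h (circ x)" and "D = circ x - w"
    have D: "D \<noteq> 0" unfolding D_def using w by (rule circ_minus_nonzero)
    have e: "circ x = D + w" and wD: "w - (D + w) = - D" by (simp_all add: D_def)
    have Re: "complex_of_real (Re a) = (a + cnj a) / 2" by (simp add: complex_add_cnj)
    have "a * (D + w) / D - (a - cnj a) / 2 - cnj a * w / (- D)
        = (D + 2 * w) / D * ((a + cnj a) / 2)"
      using D by (simp add: field_simps)
    then show ?thesis unfolding a_def[symmetric] Re unfolding e wD by (simp add: add.assoc)
  qed
  ultimately show ?thesis by simp
qed

text \<open>A continuous density of integral one on the unit interval, as a probability measure on the line.
  Its support is kept inside the half-open interval that tightness is stated with.\<close>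

lemma density_unit_interval:
  fixes p :: "real \<Rightarrow> real"
  assumes cont: "continuous_on UNIV p" and pos: "\<And>x. p x \<ge> 0" and int: "(p has_integral 1) {0..1}"
  defines "M \<equiv> density lborel (\<lambda>x. ennreal (indicator {0..1} x * p x))"
  shows "real_distribution M" "measure M {-1<..1} = 1"
    and "\<And>f :: real \<Rightarrow> complex. continuous_on UNIV f \<Longrightarrow>
           ((\<lambda>x. p x *\<^sub>R f x) has_integral integral\<^sup>L M f) {0..1}"
proof -
  have pm: "p \<in> borel_measurable borel" using cont by (rule borel_measurable_continuous_onI)
  have pi: "set_integrable lborel {0..1} p"
    by (rule borel_integrable_atLeastAtMost') (rule continuous_on_subset[OF cont], simp)
  have nn: "(\<integral>\<^sup>+ x. ennreal (indicator {0..1} x * p x) \<partial>lborel) = 1"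
  proof -
    have "(\<integral>\<^sup>+ x. ennreal (indicator {0..1} x * p x) \<partial>lborel)
        = ennreal (LINT x:{0..1}|lborel. p x)"
      unfolding set_lebesgue_integral_def
      by (subst nn_integral_eq_integral)
         (use pi pos in \<open>auto simp: set_integrable_def indicator_def\<close>)
    also have "(LINT x:{0..1}|lborel. p x) = 1"
      using set_borel_integral_eq_integral(2)[OF pi] integral_unique[OF int] by simp
    finally show ?thesis by simp
  qed
  have em: "emeasure M X = 1" if "X \<in> sets borel" "{0..1} \<subseteq> X" for X
  proof -
    have "emeasure M X = (\<integral>\<^sup>+ x. ennreal (indicator {0..1} x * p x) * indicator X x \<partial>lborel)"
      unfolding M_def by (rule emeasure_density) (use pm that in auto)
    also have "\<dots> = (\<integral>\<^sup>+ x. ennreal (indicator {0..1} x * p x) \<partial>lborel)"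
      by (rule nn_integral_cong) (use that in \<open>auto simp: indicator_def\<close>)
    finally show ?thesis using nn by simp
  qed
  have "emeasure M (space M) = 1"
    using em[of UNIV] by (simp add: M_def)
  then interpret prob_space M by (rule prob_spaceI)
  show "real_distribution M" by unfold_locales (simp add: M_def)
  show "measure M {-1<..1} = 1" using em[of "{-1<..1}"] by (simp add: measure_def subset_eq)
  fix f :: "real \<Rightarrow> complex" assume f: "continuous_on UNIV f"
  have fm: "f \<in> borel_measurable borel" using f by (rule borel_measurable_continuous_onI)
  have "integral\<^sup>L M f = (LINT x|lborel. (indicator {0..1} x * p x) *\<^sub>R f x)"
    unfolding M_def by (rule integral_density) (use fm pm pos in auto)
  also have "\<dots> = (LINT x:{0..1}|lborel. p x *\<^sub>R f x)"
    by (simp add: set_lebesgue_integral_def)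
  finally have eq: "integral\<^sup>L M f = (LINT x:{0..1}|lborel. p x *\<^sub>R f x)" .
  have "set_integrable lborel {0..1} (\<lambda>x. p x *\<^sub>R f x)"
    by (rule borel_integrable_atLeastAtMost')
       (intro continuous_intros continuous_on_subset[OF cont] continuous_on_subset[OF f] subset_UNIV)
  from set_borel_integral_eq_integral[OF this]
  show "((\<lambda>x. p x *\<^sub>R f x) has_integral integral\<^sup>L M f) {0..1}"
    unfolding eq by (simp add: integrable_integral)
qed

lemma cayley_kernel_continuous:
  assumes w: "cmod w < 1"
  shows "continuous_on UNIV (\<lambda>x. (circ x + w) / (circ x - w))"
  by (intro continuous_intros) (use circ_minus_nonzero[OF w] in auto)

lemma cayley_kernel_bounded:
  assumes w: "cmod w < 1"
  shows "cmod ((circ x + w) / (circ x - w)) \<le> 2 / (1 - cmod w)"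
proof -
  have "1 - cmod w \<le> cmod (circ x - w)" using norm_triangle_ineq2[of "circ x" w] by simp
  moreover have "cmod (circ x + w) \<le> 2" using norm_triangle_ineq[of "circ x" w] w by simp
  ultimately show ?thesis using w by (simp add: norm_divide frac_le)
qed

text \<open>On the circle of radius \<open>r < 1\<close> the Schwarz formula represents \<open>g (r w)\<close> by the probability measure
  with density \<open>Re g\<close>.  These measures live on a compact interval, so a subsequence converges weakly
  as \<open>r\<close> tends to \<open>1\<close>; the kernel is bounded and continuous, so the formula passes to the limit.\<close>

theorem Herglotz_representation_disc:
  assumes g: "g holomorphic_on ball 0 1" and pos: "\<And>w. cmod w < 1 \<Longrightarrow> Re (g w) > 0"
    and g0: "Re (g 0) = 1"
  obtains \<nu> :: "real measure" where "real_distribution \<nu>"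
    "\<And>w. cmod w < 1 \<Longrightarrow>
       g w = \<i> * of_real (Im (g 0)) + (LINT x|\<nu>. (circ x + w) / (circ x - w))"
proof -
  define r where "r n = 1 - 1 / real (n + 2)" for n
  have r: "0 < r n" "r n < 1" for n by (auto simp: r_def field_simps)
  define h where "h n = (\<lambda>u. g (of_real (r n) * u))" for n
  have hol: "h n holomorphic_on ball 0 (1 / r n)" for n
    unfolding h_def
  proof (rule holomorphic_on_compose_gen[OF _ g, unfolded o_def])
    have "cmod (of_real (r n) * u) < 1" if "cmod u < 1 / r n" for u
      using r[of n] that by (simp add: norm_mult field_simps)
    then show "(\<lambda>u. of_real (r n) * u) ` ball 0 (1 / r n) \<subseteq> ball (0::complex) 1" by auto
  qed (intro holomorphic_intros)
  have R: "1 < 1 / r n" for n using r[of n] by simp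
  define p where "p n x = Re (h n (circ x))" for n x
  have p_pos: "p n x > 0" for n x
    unfolding p_def h_def using r[of n] by (intro pos) (simp add: norm_mult)
  have p_cont: "continuous_on UNIV (p n)" for n
  proof -
    have "continuous_on (ball 0 (1 / r n)) (h n)" using hol by (rule holomorphic_on_imp_continuous_on)
    then have "continuous_on UNIV (\<lambda>x. h n (circ x))"
      by (rule continuous_on_compose2) (use R[of n] in \<open>auto intro!: continuous_intros\<close>)
    then show ?thesis unfolding p_def by (intro continuous_intros)
  qed
  have schwarz: "((\<lambda>x. p n x *\<^sub>R ((circ x + w) / (circ x - w))) has_integral
      (h n w - \<i> * of_real (Im (g 0)))) {0..1}" if "cmod w < 1" for n w
    using Schwarz_integral_formula[OF hol R that, of n]
    by (simp add: p_def h_def scaleR_conv_of_real mult.commute)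
  have p_int: "(p n has_integral 1) {0..1}" for n
  proof -
    have "h n 0 - \<i> * of_real (Im (g 0)) = 1" using g0 by (simp add: h_def complex_eq_iff)
    with schwarz[of 0 n] have "((\<lambda>x. complex_of_real (p n x)) has_integral 1) {0..1}"
      by (simp add: scaleR_conv_of_real)
    from has_integral_linear[OF this bounded_linear_Re] show ?thesis by (simp add: o_def)
  qed
  define M where "M n = density lborel (\<lambda>x. ennreal (indicator {0..1} x * p n x))" for n
  note dens = density_unit_interval[OF p_cont less_imp_le[OF p_pos] p_int, folded M_def]
  have "tight M"
    unfolding tight_def
  proof (intro conjI allI impI)
    show "\<exists>a b. a < b \<and> (\<forall>n. 1 - \<epsilon> < measure (M n) {a<..b})" if "\<epsilon> > 0" for \<epsilon> :: real
      by (rule exI[of _ "-1"], rule exI[of _ 1]) (simp add: dens(2) that)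
  qed (rule dens(1))
  from tight_imp_convergent_subsubsequence[OF this strict_mono_id]
  obtain s \<nu> where s: "strict_mono s" and \<nu>: "real_distribution \<nu>" and conv: "weak_conv_m (M \<circ> s) \<nu>"
    by auto
  show thesis
  proof (rule that[OF \<nu>])
    fix w :: complex assume w: "cmod w < 1"
    let ?k = "\<lambda>x. (circ x + w) / (circ x - w)"
    have "(\<lambda>n. integral\<^sup>L ((M \<circ> s) n) ?k) \<longlonglongrightarrow> integral\<^sup>L \<nu> ?k"
    proof (rule weak_conv_imp_integral_bdd_continuous_conv[OF _ \<nu> conv])
      show "isCont ?k x" for x
        using cayley_kernel_continuous[OF w] by (simp add: continuous_on_eq_continuous_at)
      show "cmod (?k x) \<le> 2 / (1 - cmod w)" for x by (rule cayley_kernel_bounded[OF w])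
    qed (use dens(1) in simp)
    moreover have "integral\<^sup>L (M n) ?k = h n w - \<i> * of_real (Im (g 0))" for n
      using has_integral_unique[OF dens(3)[OF cayley_kernel_continuous[OF w]] schwarz[OF w]] .
    moreover have "(\<lambda>n. h (s n) w) \<longlonglongrightarrow> g w"
    proof -
      have "r \<longlonglongrightarrow> 1 - 0" unfolding r_def
        by (intro tendsto_intros LIMSEQ_ignore_initial_segment[OF lim_1_over_n])
      then have "(\<lambda>n. of_real (r n) * w) \<longlonglongrightarrow> of_real (1 - 0) * w" by (intro tendsto_intros)
      then have "(\<lambda>n. of_real (r (s n)) * w) \<longlonglongrightarrow> w"
        using LIMSEQ_subseq_LIMSEQ[OF _ s] by (fastforce simp: o_def)
      moreover have "isCont g w"
        using holomorphic_on_imp_continuous_on[OF g] w by (simp add: continuous_on_eq_continuous_at)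
      ultimately show ?thesis unfolding h_def by (rule isCont_tendsto_compose[rotated])
    qed
    then have "(\<lambda>n. h (s n) w - \<i> * of_real (Im (g 0))) \<longlonglongrightarrow> g w - \<i> * of_real (Im (g 0))"
      by (intro tendsto_intros)
    ultimately have "integral\<^sup>L \<nu> ?k = g w - \<i> * of_real (Im (g 0))"
      by (simp add: LIMSEQ_unique)
    then show "g w = \<i> * of_real (Im (g 0)) + integral\<^sup>L \<nu> ?k" by simp
  qed
qed

section \<open>The Nevanlinna representation on the upper half-plane\<close>

text \<open>The kernel of the disc representation, multiplied by \<open>i\<close>, at the Cayley image of \<open>z\<close>.\<close>

definition cayley_kernel :: "complex \<Rightarrow> real \<Rightarrow> complex" where
  "cayley_kernel z x =
     \<i> * ((circ x + (z - \<i>) / (z + \<i>)) / (circ x - (z - \<i>) / (z + \<i>)))"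

lemma cayley_norm_less_1:
  assumes "Im z > 0"
  shows "cmod ((z - \<i>) / (z + \<i>)) < 1"
proof -
  have "(cmod (z - \<i>))\<^sup>2 < (cmod (z + \<i>))\<^sup>2"
    unfolding cmod_power2 using assms by (simp add: power2_eq_square algebra_simps)
  then have "cmod (z - \<i>) < cmod (z + \<i>)" by (rule power2_less_imp_less) simp
  then show ?thesis by (auto simp: norm_divide divide_less_eq_1)
qed

text \<open>The disc representation of \<open>w \<mapsto> - i F (i (1 + w) / (1 - w))\<close>.\<close>

theorem Herglotz_representation_half_plane:
  assumes F: "herglotz_nevanlinna F" and Fi: "Im (F \<i>) = 1"
  obtains \<nu> :: "real measure" where "real_distribution \<nu>"
    "\<And>z. Im z > 0 \<Longrightarrow> F z = of_real (Re (F \<i>)) + (LINT x|\<nu>. cayley_kernel z x)"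
proof -
  define m where "m w = \<i> * ((1 + w) / (1 - w))" for w :: complex
  have Im_m: "Im (m w) > 0" if "cmod w < 1" for w
  proof -
    have w1: "1 - w \<noteq> 0" using that by auto
    have "m w = \<i> * ((1 + w) * cnj (1 - w)) / of_real ((cmod (1 - w))\<^sup>2)"
      unfolding m_def complex_norm_square using w1 by simp
    then have "Im (m w) = Re ((1 + w) * cnj (1 - w)) / (cmod (1 - w))\<^sup>2"
      by (simp add: Im_divide_of_real del: of_real_power)
    also have "Re ((1 + w) * cnj (1 - w)) = 1 - (cmod w)\<^sup>2"
      unfolding cmod_power2 by (simp add: power2_eq_square algebra_simps)
    finally show ?thesis using that w1 by (simp add: power_less_one_iff abs_square_less_1)
  qed
  define g where "g w = - \<i> * F (m w)" for w
  have "m holomorphic_on ball 0 1" unfolding m_def by (intro holomorphic_intros) auto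
  then have "(\<lambda>w. F (m w)) holomorphic_on ball 0 1"
    using F Im_m by (intro holomorphic_on_compose_gen[of m _ F "{z. Im z > 0}", unfolded o_def])
      (auto simp: herglotz_nevanlinna_def)
  then have g: "g holomorphic_on ball 0 1" unfolding g_def by (intro holomorphic_intros)
  have pos: "Re (g w) > 0" if "cmod w < 1" for w
    using F Im_m[OF that] by (simp add: g_def herglotz_nevanlinna_def)
  have m0: "m 0 = \<i>" by (simp add: m_def)
  obtain \<nu> where \<nu>: "real_distribution \<nu>" and
    rep: "\<And>w. cmod w < 1 \<Longrightarrow>
       g w = \<i> * of_real (Im (g 0)) + (LINT x|\<nu>. (circ x + w) / (circ x - w))"
    by (rule Herglotz_representation_disc[OF g pos]) (use Fi in \<open>simp_all add: g_def m0\<close>)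
  show thesis
  proof (rule that[OF \<nu>])
    fix z :: complex assume z: "Im z > 0"
    define w where "w = (z - \<i>) / (z + \<i>)"
    have zi: "z + \<i> \<noteq> 0" using z by (auto simp: complex_eq_iff)
    have "1 - w = 2 * \<i> / (z + \<i>)" "1 + w = 2 * z / (z + \<i>)"
      using zi by (auto simp: w_def field_simps)
    then have "m w = z" using zi by (simp add: m_def)
    then have "F z = \<i> * g w" by (simp add: g_def)
    also have "g w = \<i> * of_real (Im (g 0)) + (LINT x|\<nu>. (circ x + w) / (circ x - w))"
      unfolding w_def by (rule rep[OF cayley_norm_less_1[OF z]])
    also have "Im (g 0) = - Re (F \<i>)" by (simp add: g_def m0)
    also have "\<i> * (\<i> * of_real (- Re (F \<i>)) + (LINT x|\<nu>. (circ x + w) / (circ x - w)))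
        = of_real (Re (F \<i>)) + \<i> * (LINT x|\<nu>. (circ x + w) / (circ x - w))"
      unfolding distrib_left mult.assoc[symmetric] by simp
    also have "\<i> * (LINT x|\<nu>. (circ x + w) / (circ x - w)) = (LINT x|\<nu>. cayley_kernel z x)"
      unfolding cayley_kernel_def w_def by (rule integral_mult_right_zero[symmetric])
    finally show "F z = of_real (Re (F \<i>)) + (LINT x|\<nu>. cayley_kernel z x)" .
  qed
qed

text \<open>The real point \<open>- cot (\<pi> x)\<close> which the Cayley transform sends to \<open>circ x\<close>.  The value at
  \<open>circ x = 1\<close>, the image of infinity, is arbitrary.\<close>

definition cayley_point :: "real \<Rightarrow> real" where "cayley_point x = Re (\<i> * (1 + circ x) / (1 - circ x))"

text \<open>Mass at the boundary point corresponding to infinity produces the linear term of the Nevanlinna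
  representation.\<close>

lemma cayley_kernel_circ_1:
  assumes "circ x = 1" "Im z > 0"
  shows "cayley_kernel z x = z"
proof -
  have zi: "z + \<i> \<noteq> 0" using assms(2) by (auto simp: complex_eq_iff)
  have "1 - (z - \<i>) / (z + \<i>) = 2 * \<i> / (z + \<i>)" "1 + (z - \<i>) / (z + \<i>) = 2 * z / (z + \<i>)"
    using zi by (auto simp: field_simps)
  then show ?thesis using zi by (simp add: cayley_kernel_def assms(1))
qed

lemma of_real_cayley_point:
  assumes "circ x \<noteq> 1"
  shows "of_real (cayley_point x) = \<i> * (1 + circ x) / (1 - circ x)"
proof -
  define t where "t = \<i> * (1 + circ x) / (1 - circ x)"
  have "cnj t = - \<i> * (1 + 1 / circ x) / (1 - 1 / circ x)"
    unfolding circ_cnj[symmetric] by (simp add: t_def)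
  also have "\<dots> = t"
    using assms by (simp add: t_def field_simps)
  finally have "Im (cnj t) = Im t" by simp
  then have "Im t = 0" by simp
  then show ?thesis unfolding cayley_point_def t_def[symmetric] by (simp add: complex_eq_iff)
qed

lemma cayley_kernel_eq:
  assumes x: "circ x \<noteq> 1" and z: "Im z > 0"
  shows "cayley_kernel z x = (1 + of_real (cayley_point x) * z) / (of_real (cayley_point x) - z)"
proof -
  define e where "e = circ x"
  define t where "t = complex_of_real (cayley_point x)"
  have e1: "1 - e \<noteq> 0" using x by (simp add: e_def)
  have zi: "z + \<i> \<noteq> 0" using z by (auto simp: complex_eq_iff)
  have tz: "t - z \<noteq> 0" using z by (auto simp: t_def complex_eq_iff)
  have t: "t * (1 - e) = \<i> * (1 + e)"
    using of_real_cayley_point[OF x] e1 by (simp add: t_def e_def)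
  have ez: "e - (z - \<i>) / (z + \<i>) \<noteq> 0"
    unfolding e_def by (rule circ_minus_nonzero[OF cayley_norm_less_1[OF z]])
  then have ez': "e * (z + \<i>) - (z - \<i>) \<noteq> 0" using zi by (simp add: field_simps)
  have "e + (z - \<i>) / (z + \<i>) = (e * (z + \<i>) + (z - \<i>)) / (z + \<i>)"
    and "e - (z - \<i>) / (z + \<i>) = (e * (z + \<i>) - (z - \<i>)) / (z + \<i>)"
    using zi by (simp_all add: add_divide_distrib diff_divide_distrib)
  then have "cayley_kernel z x = \<i> * (e * (z + \<i>) + (z - \<i>)) / (e * (z + \<i>) - (z - \<i>))"
    unfolding cayley_kernel_def e_def[symmetric] using zi by simp
  also have "\<dots> = (1 + t * z) / (t - z)"
  proof -
    have "(1 - e) * (\<i> * (e * (z + \<i>) + (z - \<i>)) * (t - z))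
        = (1 - e) * ((1 + t * z) * (e * (z + \<i>) - (z - \<i>)))"
    proof -
      have "(1 - e) * (\<i> * (e * (z + \<i>) + (z - \<i>)) * (t - z))
          = \<i> * (e * (z + \<i>) + (z - \<i>)) * (t * (1 - e) - z * (1 - e))"
        by (simp add: algebra_simps)
      also have "\<dots> = (1 - e + t * (1 - e) * z) * (e * (z + \<i>) - (z - \<i>))"
        unfolding t by (simp add: algebra_simps)
      also have "\<dots> = (1 - e) * ((1 + t * z) * (e * (z + \<i>) - (z - \<i>)))"
        by (simp add: algebra_simps)
      finally show ?thesis .
    qed
    then have "\<i> * (e * (z + \<i>) + (z - \<i>)) * (t - z) = (1 + t * z) * (e * (z + \<i>) - (z - \<i>))"
      using e1 by simp
    then show ?thesis using tz ez' by (simp add: frac_eq_eq)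
  qed
  finally show ?thesis by (simp add: t_def)
qed

abbreviation nkernel :: "complex \<Rightarrow> real \<Rightarrow> complex" where
  "nkernel z l \<equiv> 1 / (complex_of_real l - z) - complex_of_real (l / (1 + l\<^sup>2))"

lemma nkernel_factor:
  assumes "Im z \<noteq> 0"
  shows "nkernel z l = (1 + of_real l * z) / (of_real l - z) / of_real (1 + l\<^sup>2)"
proof -
  have 1: "complex_of_real l - z \<noteq> 0" using assms by (auto simp: complex_eq_iff)
  have "1 + l\<^sup>2 \<noteq> 0" by (smt (verit) zero_le_power2)
  then have 2: "complex_of_real (1 + l\<^sup>2) \<noteq> 0" by (simp only: of_real_eq_0_iff not_False_eq_True)
  show ?thesis unfolding of_real_divide using 1 2
    by (simp add: diff_frac_eq divide_divide_eq_left) (simp add: power2_eq_square algebra_simps)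
qed

lemma cayley_kernel_bounded_measurable:
  assumes z: "Im z > 0"
  shows "cayley_kernel z \<in> borel_measurable borel"
    and "\<exists>B. \<forall>x. cmod (cayley_kernel z x) \<le> B"
proof -
  note w = cayley_norm_less_1[OF z]
  show "cayley_kernel z \<in> borel_measurable borel"
    unfolding cayley_kernel_def
    by (intro borel_measurable_continuous_onI continuous_on_mult continuous_on_const
        cayley_kernel_continuous w)
  show "\<exists>B. \<forall>x. cmod (cayley_kernel z x) \<le> B"
    unfolding cayley_kernel_def norm_mult using cayley_kernel_bounded[OF w] by auto
qed

lemma Im_cayley_kernel_nonneg:
  assumes z: "Im z > 0"
  shows "Im (cayley_kernel z x) \<ge> 0"
proof (cases "circ x = 1")
  case True
  then show ?thesis using z by (simp add: cayley_kernel_circ_1)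
next
  case False
  define t where "t = cayley_point x"
  have d: "of_real t - z \<noteq> 0" using z by (auto simp: complex_eq_iff)
  have "cayley_kernel z x = (1 + of_real t * z) / (of_real t - z)"
    using cayley_kernel_eq[OF False z] by (simp add: t_def)
  also have "\<dots> = (1 + of_real t * z) * cnj (of_real t - z) / of_real ((cmod (of_real t - z))\<^sup>2)"
    unfolding complex_norm_square using d
    by (intro mult_divide_mult_cancel_right[symmetric]) (simp only: complex_cnj_zero_iff not_False_eq_True)
  finally have "Im (cayley_kernel z x)
      = Im ((1 + of_real t * z) * cnj (of_real t - z)) / (cmod (of_real t - z))\<^sup>2"
    by (simp only: Im_divide_of_real)
  also have "Im ((1 + of_real t * z) * cnj (of_real t - z)) = (1 + t\<^sup>2) * Im z"
    by (simp add: power2_eq_square algebra_simps)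
  finally show ?thesis using z by simp
qed

text \<open>The mass \<open>b\<close> that the Herglotz measure has over the point at infinity contributes \<open>b y\<close> to
  \<open>Im F(iy)\<close>, and the other contributions are nonnegative; growth slower than linear therefore means
  \<open>b = 0\<close>.  The rest of the measure is moved to the line and weighted with \<open>1 + l\<^sup>2\<close>, the factor
  between the two kernels, which turns total mass one into the normalisation
  \<open>\<integral> 1 / (1 + l\<^sup>2) d\<mu> = 1\<close>.\<close>

theorem Nevanlinna_representation_sublinear:
  assumes F: "herglotz_nevanlinna F" and Fi: "Im (F \<i>) = 1"
    and sub: "\<And>b. b > 0 \<Longrightarrow> \<exists>y>0. Im (F (\<i> * of_real y)) < b * y"
  obtains \<mu> :: "real measure" where "sets \<mu> = sets borel"
    "(\<integral>\<^sup>+ l. ennreal (1 / (1 + l\<^sup>2)) \<partial>\<mu>) = 1"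
    "\<And>z. Im z > 0 \<Longrightarrow> F z = of_real (Re (F \<i>)) +
       (LINT l|\<mu>. nkernel z l)"
proof -
  obtain \<nu> :: "real measure" where \<nu>: "real_distribution \<nu>" and
    rep: "\<And>z. Im z > 0 \<Longrightarrow> F z = of_real (Re (F \<i>)) + (LINT x|\<nu>. cayley_kernel z x)"
    using Herglotz_representation_half_plane[OF F Fi] by metis
  interpret real_distribution \<nu> by fact
  define N where "N = {x. circ x = 1}"
  have "closed N" unfolding N_def by (intro closed_Collect_eq continuous_intros)
  then have N [measurable]: "N \<in> sets borel" by (rule borel_closed)
  have int: "integrable \<nu> (cayley_kernel z)" if "Im z > 0" for z
  proof -
    from cayley_kernel_bounded_measurable[OF that] obtain B
      where "\<And>x. cmod (cayley_kernel z x) \<le> B" "cayley_kernel z \<in> borel_measurable borel" by blast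
    then show ?thesis by (intro integrable_const_bound[of _ B]) auto
  qed
  have lower: "measure \<nu> N * y \<le> Im (F (\<i> * of_real y))" if y: "y > 0" for y
  proof -
    have z: "Im (\<i> * of_real y) > 0" using y by simp
    have "measure \<nu> N * y = (LINT x|\<nu>. indicator N x * y)" by simp
    also have "\<dots> \<le> (LINT x|\<nu>. Im (cayley_kernel (\<i> * of_real y) x))"
    proof (rule integral_mono)
      show "integrable \<nu> (\<lambda>x. indicator N x * y)"
        by (intro integrable_mult_left integrable_real_indicator) (auto simp: emeasure_eq_measure)
      show "integrable \<nu> (\<lambda>x. Im (cayley_kernel (\<i> * of_real y) x))"
        using int[OF z] by (rule integrable_Im)
      show "indicator N x * y \<le> Im (cayley_kernel (\<i> * of_real y) x)" for x
        using cayley_kernel_circ_1[OF _ z, of x] Im_cayley_kernel_nonneg[OF z, of x]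
        by (auto simp: N_def indicator_def)
    qed
    also have "\<dots> = Im (LINT x|\<nu>. cayley_kernel (\<i> * of_real y) x)"
      using int[OF z] by (rule integral_Im)
    also have "\<dots> = Im (F (\<i> * of_real y))" unfolding rep[OF z] by simp
    finally show ?thesis .
  qed
  have "measure \<nu> N = 0"
  proof (rule ccontr)
    assume "measure \<nu> N \<noteq> 0"
    then have "measure \<nu> N > 0" by (simp add: zero_less_measure_iff)
    from sub[OF this] lower show False by (meson not_less)
  qed
  then have "emeasure \<nu> N = 0" by (simp add: emeasure_eq_measure)
  then have AE: "AE x in \<nu>. circ x \<noteq> 1"
    by (intro AE_I[of _ _ N]) (use N in \<open>auto simp: N_def\<close>)
  have cayley_point_measurable [measurable]: "cayley_point \<in> borel_measurable borel"
  proof -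
    have "circ \<in> borel_measurable borel"
      by (intro borel_measurable_continuous_onI continuous_intros)
    then show ?thesis unfolding cayley_point_def by measurable
  qed
  define \<mu> where "\<mu> = density (distr \<nu> borel cayley_point) (\<lambda>l. ennreal (1 + l\<^sup>2))"
  have p: "1 + l\<^sup>2 > 0" for l :: real by (smt (verit) zero_le_power2)
  show thesis
  proof (rule that)
    show "sets \<mu> = sets borel" by (simp add: \<mu>_def)
    have "(\<integral>\<^sup>+ l. ennreal (1 / (1 + l\<^sup>2)) \<partial>\<mu>)
        = (\<integral>\<^sup>+ l. ennreal (1 + l\<^sup>2) * ennreal (1 / (1 + l\<^sup>2)) \<partial>distr \<nu> borel cayley_point)"
      unfolding \<mu>_def by (rule nn_integral_density) auto
    also have "\<dots> = (\<integral>\<^sup>+ l. 1 \<partial>distr \<nu> borel cayley_point)"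
      using p by (intro nn_integral_cong) (simp add: ennreal_mult[symmetric] less_imp_le less_imp_neq[symmetric] del: ennreal_plus)
    also have "\<dots> = emeasure (distr \<nu> borel cayley_point) (space (distr \<nu> borel cayley_point))" by simp
    also have "\<dots> = 1" by (intro prob_space.emeasure_space_1 prob_space_distr) simp
    finally show "(\<integral>\<^sup>+ l. ennreal (1 / (1 + l\<^sup>2)) \<partial>\<mu>) = 1" .
    fix z :: complex assume z: "Im z > 0"
    let ?k = "\<lambda>l. 1 / (complex_of_real l - z) - complex_of_real (l / (1 + l\<^sup>2))"
    have "integral\<^sup>L \<mu> ?k = (LINT l|distr \<nu> borel cayley_point. (1 + l\<^sup>2) *\<^sub>R ?k l)"
      unfolding \<mu>_def by (rule integral_density) (auto simp: less_imp_le[OF p])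
    also have "\<dots> = (LINT x|\<nu>. (1 + (cayley_point x)\<^sup>2) *\<^sub>R ?k (cayley_point x))"
      by (rule integral_distr) auto
    also have "\<dots> = (LINT x|\<nu>. cayley_kernel z x)"
    proof (rule integral_cong_AE)
      show "AE x in \<nu>. (1 + (cayley_point x)\<^sup>2) *\<^sub>R ?k (cayley_point x) = cayley_kernel z x"
        using AE
      proof eventually_elim
        case (elim x)
        have "complex_of_real (1 + (cayley_point x)\<^sup>2) \<noteq> 0"
          using p[of "cayley_point x"] by (simp only: of_real_eq_0_iff)
        moreover have "Im z \<noteq> 0" using z by simp
        ultimately show ?case
          unfolding nkernel_factor[OF \<open>Im z \<noteq> 0\<close>] cayley_kernel_eq[OF elim z] scaleR_conv_of_real
          by (simp del: of_real_add)
      qed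
    qed (use cayley_kernel_bounded_measurable(1)[OF z] in auto)
    finally show "F z = of_real (Re (F \<i>)) + integral\<^sup>L \<mu> ?k" using rep[OF z] by simp
  qed
qed

lemma one_plus_square_pos: "1 + l\<^sup>2 > (0::real)"
  by (smt (verit) zero_le_power2)

lemma integrable_Cauchy_weight:
  assumes [measurable_cong]: "sets \<mu> = sets borel"
    and one: "(\<integral>\<^sup>+ l. ennreal (1 / (1 + l\<^sup>2)) \<partial>\<mu>) = 1"
  shows "integrable \<mu> (\<lambda>l::real. 1 / (1 + l\<^sup>2))" "(LINT l|\<mu>. 1 / (1 + l\<^sup>2)) = 1"
proof -
  have pos: "0 \<le> 1 / (1 + l\<^sup>2)" for l :: real using one_plus_square_pos[of l] by simp
  show i: "integrable \<mu> (\<lambda>l::real. 1 / (1 + l\<^sup>2))"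
    using one pos by (intro integrableI_nonneg) auto
  show "(LINT l|\<mu>. 1 / (1 + l\<^sup>2)) = 1"
    using nn_integral_eq_integral[OF i] pos one by simp
qed

lemma norm_resolvent_kernel:
  assumes "y > 0"
  shows "(cmod (of_real l - \<i> * of_real y))\<^sup>2 = l\<^sup>2 + y\<^sup>2"
    and "cmod (1 / (of_real l - \<i> * of_real y)) \<le> 1 / y"
    and "Im (1 / (of_real l - \<i> * of_real y)) = y / (l\<^sup>2 + y\<^sup>2)"
    and "of_real l - \<i> * complex_of_real y \<noteq> 0"
proof -
  show n: "(cmod (of_real l - \<i> * of_real y))\<^sup>2 = l\<^sup>2 + y\<^sup>2"
    unfolding cmod_power2 by simp
  have "y = \<bar>Im (of_real l - \<i> * complex_of_real y)\<bar>" using assms by simp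
  also have "\<dots> \<le> cmod (of_real l - \<i> * complex_of_real y)" by (rule abs_Im_le_cmod)
  finally show "cmod (1 / (of_real l - \<i> * of_real y)) \<le> 1 / y"
    using assms by (simp add: norm_divide frac_le)
  show "Im (1 / (of_real l - \<i> * of_real y)) = y / (l\<^sup>2 + y\<^sup>2)"
    by (simp add: Im_divide)
  show "of_real l - \<i> * complex_of_real y \<noteq> 0" using assms by (auto simp: complex_eq_iff)
qed

lemma norm_nkernel_le:
  assumes y: "y \<ge> 1"
  shows "cmod (nkernel (\<i> * of_real y) l) \<le> y * (1 / (1 + l\<^sup>2))"
proof -
  let ?z = "\<i> * complex_of_real y"
  have z: "Im ?z \<noteq> 0" and y0: "y > 0" using y by auto
  have "(cmod (1 + of_real l * ?z))\<^sup>2 = 1 + l\<^sup>2 * y\<^sup>2"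
    unfolding cmod_power2 by (simp add: power_mult_distrib)
  also have "\<dots> \<le> y\<^sup>2 * (l\<^sup>2 + y\<^sup>2)"
    using power_mono[of 1 y 4] y by (simp add: algebra_simps power2_eq_square power4_eq_xxxx)
  also have "\<dots> = (y * cmod (of_real l - ?z))\<^sup>2"
    using norm_resolvent_kernel(1)[OF y0, of l] by (simp add: power_mult_distrib)
  finally have "cmod (1 + of_real l * ?z) \<le> y * cmod (of_real l - ?z)"
    by (rule power2_le_imp_le) (use y in simp)
  then have "cmod ((1 + of_real l * ?z) / (of_real l - ?z)) \<le> y"
    using norm_resolvent_kernel(4)[OF y0, of l] by (simp add: norm_divide divide_le_eq)
  moreover have "cmod (of_real (1 + l\<^sup>2)) = 1 + l\<^sup>2"
    using one_plus_square_pos[of l] unfolding norm_of_real by simp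
  ultimately show ?thesis
    unfolding nkernel_factor[OF z] norm_divide[of _ "complex_of_real _"]
    using one_plus_square_pos[of l] by (simp add: divide_right_mono)
qed

lemma Im_Nevanlinna_integral:
  assumes [measurable_cong]: "sets \<mu> = sets borel"
    and one: "(\<integral>\<^sup>+ l. ennreal (1 / (1 + l\<^sup>2)) \<partial>\<mu>) = 1"
    and y: "y \<ge> 1"
  shows "integrable \<mu> (\<lambda>l. y / (l\<^sup>2 + y\<^sup>2))"
    and "Im (LINT l|\<mu>. nkernel (\<i> * of_real y) l) = (LINT l|\<mu>. y / (l\<^sup>2 + y\<^sup>2))"
proof -
  have y0: "y > 0" using y by simp
  have "integrable \<mu> (\<lambda>l. y * (1 / (1 + l\<^sup>2)))"
    by (intro integrable_mult_right integrable_Cauchy_weight assms)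
  then have int: "integrable \<mu> (nkernel (\<i> * of_real y))"
  proof (rule Bochner_Integration.integrable_bound)
    show "AE l in \<mu>. cmod (nkernel (\<i> * of_real y) l) \<le> norm (y * (1 / (1 + l\<^sup>2)))"
      using norm_nkernel_le[OF y] one_plus_square_pos y0 by (auto intro!: AE_I2)
  qed measurable
  have Im: "Im (nkernel (\<i> * of_real y) l) = y / (l\<^sup>2 + y\<^sup>2)" for l
    using norm_resolvent_kernel(3)[OF y0, of l] by simp
  show "integrable \<mu> (\<lambda>l. y / (l\<^sup>2 + y\<^sup>2))"
    using integrable_Im[OF int] unfolding Im .
  show "Im (LINT l|\<mu>. nkernel (\<i> * of_real y) l) = (LINT l|\<mu>. y / (l\<^sup>2 + y\<^sup>2))"
    using integral_Im[OF int] unfolding Im by simp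
qed

section \<open>Growth along the imaginary axis\<close>

text \<open>The limits along the imaginary axis are taken along this sequence, which starts at \<open>1\<close> because the
  estimates of the kernel hold for \<open>y \<ge> 1\<close>.\<close>

definition height :: "nat \<Rightarrow> real" where "height n = real (Suc n)"

lemma height_ge_1: "height n \<ge> 1" by (simp add: height_def)

lemma filterlim_height: "filterlim height at_top sequentially"
  unfolding height_def by (rule filterlim_compose[OF filterlim_real_sequentially filterlim_Suc])

text \<open>Both limits concern \<open>Im V(iy) = \<integral> y / (l\<^sup>2 + y\<^sup>2) d\<mu>\<close>.  Divided by \<open>y\<close>, the integrand tends to zero and is
  dominated by \<open>1 / (1 + l\<^sup>2)\<close>.  Multiplied by \<open>y\<close>, it is at least \<open>1 / 2\<close> on \<open>[-y, y]\<close>, and the measure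
  of this interval is unbounded.\<close>

lemma M_class_asymptotics:
  assumes V: "V \<in> M_class Q"
  shows "(\<lambda>n. Im (V (\<i> * of_real (height n))) / height n) \<longlonglongrightarrow> 0"
    and "filterlim (\<lambda>n. height n * Im (V (\<i> * of_real (height n)))) at_top sequentially"
    and "V \<i> = of_real Q + \<i>"
proof -
  obtain \<mu> :: "real measure" where sets [measurable_cong]: "sets \<mu> = sets borel"
    and inf: "emeasure \<mu> UNIV = \<infinity>"
    and one: "(\<integral>\<^sup>+ l. ennreal (1 / (1 + l\<^sup>2)) \<partial>\<mu>) = 1"
    and rep: "\<And>z. Im z > 0 \<Longrightarrow> V z = of_real Q + (LINT l|\<mu>. nkernel z l)"
    using V unfolding M_class_def by blast
  have space [simp]: "space \<mu> = UNIV" using sets_eq_imp_space_eq[OF sets] by simp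
  have height_pos: "height n > 0" for n by (simp add: height_def)
  have ImV: "Im (V (\<i> * of_real y)) = (LINT l|\<mu>. y / (l\<^sup>2 + y\<^sup>2))" if "y \<ge> 1" for y
    using rep[of "\<i> * of_real y"] Im_Nevanlinna_integral(2)[OF sets one that] that by simp
  have "(\<lambda>n. LINT l|\<mu>. 1 / (l\<^sup>2 + (height n)\<^sup>2)) \<longlonglongrightarrow> (LINT l|\<mu>. 0)"
  proof (rule integral_dominated_convergence[where w = "\<lambda>l. 1 / (1 + l\<^sup>2)"])
    show "integrable \<mu> (\<lambda>l. 1 / (1 + l\<^sup>2))" by (rule integrable_Cauchy_weight[OF sets one])
    show "AE l in \<mu>. (\<lambda>n. 1 / (l\<^sup>2 + (height n)\<^sup>2)) \<longlonglongrightarrow> 0"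
    proof (rule AE_I2)
      fix l
      have "filterlim (\<lambda>n. l\<^sup>2 + (height n)\<^sup>2) at_top sequentially"
        by (intro filterlim_tendsto_add_at_top[OF tendsto_const] filterlim_pow_at_top filterlim_height) simp
      then show "(\<lambda>n. 1 / (l\<^sup>2 + (height n)\<^sup>2)) \<longlonglongrightarrow> 0"
        by (intro tendsto_divide_0[OF tendsto_const] filterlim_at_top_imp_at_infinity)
    qed
    show "AE l in \<mu>. norm (1 / (l\<^sup>2 + (height n)\<^sup>2)) \<le> 1 / (1 + l\<^sup>2)" for n
    proof (rule AE_I2)
      fix l :: real
      have "1 \<le> (height n)\<^sup>2" using height_ge_1 by (simp add: one_le_power)
      moreover have "0 \<le> l\<^sup>2" by simp
      ultimately show "norm (1 / (l\<^sup>2 + (height n)\<^sup>2)) \<le> 1 / (1 + l\<^sup>2)"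
        by (simp add: frac_le one_plus_square_pos)
    qed
  qed measurable
  moreover have "Im (V (\<i> * of_real (height n))) / height n = (LINT l|\<mu>. 1 / (l\<^sup>2 + (height n)\<^sup>2))" for n
  proof -
    have cancel: "height n / x / height n = 1 / x" for x using height_pos[of n] by simp
    have "Im (V (\<i> * of_real (height n))) / height n = (LINT l|\<mu>. height n / (l\<^sup>2 + (height n)\<^sup>2) / height n)"
      unfolding ImV[OF height_ge_1] by (rule integral_divide_zero[symmetric])
    also have "\<dots> = (LINT l|\<mu>. 1 / (l\<^sup>2 + (height n)\<^sup>2))"
      by (simp only: cancel)
    finally show ?thesis .
  qed
  ultimately show "(\<lambda>n. Im (V (\<i> * of_real (height n))) / height n) \<longlonglongrightarrow> 0" by simp
  have lower: "emeasure \<mu> {- height n..height n} \<le> ennreal (2 * (height n * Im (V (\<i> * of_real (height n)))))" for n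
  proof -
    let ?y = "height n"
    let ?f = "\<lambda>l. 2 * (?y * (?y / (l\<^sup>2 + ?y\<^sup>2)))"
    have f0: "0 \<le> ?f l" for l using height_pos[of n] by simp
    have int: "integrable \<mu> ?f"
      by (intro integrable_mult_right Im_Nevanlinna_integral(1)[OF sets one height_ge_1])
    have "emeasure \<mu> {- ?y..?y} = (\<integral>\<^sup>+ l. indicator {- ?y..?y} l \<partial>\<mu>)" by simp
    also have "\<dots> \<le> (\<integral>\<^sup>+ l. ennreal (?f l) \<partial>\<mu>)"
    proof (rule nn_integral_mono)
      fix l
      have "1 \<le> ?f l" if "l \<in> {- ?y..?y}"
      proof -
        have "\<bar>l\<bar> \<le> ?y" using that by auto
        then have "l\<^sup>2 \<le> ?y\<^sup>2" using power_mono[of "\<bar>l\<bar>" ?y 2] by simp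
        then have "l\<^sup>2 + ?y\<^sup>2 \<le> 2 * (?y * ?y)" by (simp add: power2_eq_square)
        moreover have "0 < l\<^sup>2 + ?y\<^sup>2" using height_pos[of n] by (simp add: add_nonneg_pos)
        ultimately show ?thesis by (simp add: le_divide_eq)
      qed
      then show "indicator {- ?y..?y} l \<le> ennreal (?f l)"
        using ennreal_leI[of 1 "?f l"] by (auto simp: indicator_def)
    qed
    also have "\<dots> = ennreal (LINT l|\<mu>. ?f l)"
      by (rule nn_integral_eq_integral[OF int]) (use f0 in auto)
    also have "(LINT l|\<mu>. ?f l) = 2 * (?y * Im (V (\<i> * of_real ?y)))"
      unfolding ImV[OF height_ge_1] by (simp only: integral_mult_right_zero)
    finally show ?thesis .
  qed
  have "(\<lambda>n. emeasure \<mu> {- height n..height n}) \<longlonglongrightarrow> emeasure \<mu> (\<Union>n. {- height n..height n})"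
  proof (rule Lim_emeasure_incseq)
    show "incseq (\<lambda>n. {- height n..height n})" by (rule incseq_SucI) (auto simp: height_def)
  qed (auto simp: sets)
  also have "(\<Union>n. {- height n..height n}) = UNIV"
  proof -
    have "l \<in> (\<Union>n. {- height n..height n})" for l
    proof -
      obtain n where "\<bar>l\<bar> \<le> real n" using real_arch_simple[of "\<bar>l\<bar>"] by blast
      then have "l \<in> {- height n..height n}" by (auto simp: height_def)
      then show ?thesis by blast
    qed
    then show ?thesis by blast
  qed
  finally have lim: "(\<lambda>n. emeasure \<mu> {- height n..height n}) \<longlonglongrightarrow> \<infinity>" by (simp add: inf)
  show "filterlim (\<lambda>n. height n * Im (V (\<i> * of_real (height n)))) at_top sequentially"
    unfolding filterlim_at_top
  proof
    fix C :: real
    have "eventually (\<lambda>n. ennreal (2 * C) < emeasure \<mu> {- height n..height n}) sequentially"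
      by (rule order_tendstoD(1)[OF lim]) simp
    then show "eventually (\<lambda>n. C \<le> height n * Im (V (\<i> * of_real (height n)))) sequentially"
    proof eventually_elim
      case (elim n)
      then have "ennreal (2 * C) < ennreal (2 * (height n * Im (V (\<i> * of_real (height n)))))"
        using lower[of n] by (rule less_le_trans)
      then have "\<not> 2 * (height n * Im (V (\<i> * of_real (height n)))) \<le> 2 * C"
        by (meson ennreal_leI leD)
      then show ?case by simp
    qed
  qed
  have "nkernel \<i> l = \<i> * of_real (1 / (1 + l\<^sup>2))" for l
  proof -
    have "1 + of_real l * \<i> = \<i> * (complex_of_real l - \<i>)" by (simp add: algebra_simps)
    moreover have "complex_of_real l - \<i> \<noteq> 0" by (simp add: complex_eq_iff)
    ultimately have "(1 + of_real l * \<i>) / (complex_of_real l - \<i>) = \<i>" by simp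
    then show ?thesis by (subst nkernel_factor) (simp_all)
  qed
  then have "V \<i> = of_real Q + (LINT l|\<mu>. \<i> * of_real (1 / (1 + l\<^sup>2)))"
    using rep[of \<i>] by simp
  also have "(LINT l|\<mu>. \<i> * complex_of_real (1 / (1 + l\<^sup>2))) = \<i> * of_real (LINT l|\<mu>. 1 / (1 + l\<^sup>2))"
    by (simp only: integral_mult_right_zero integral_complex_of_real)
  finally show "V \<i> = of_real Q + \<i>" unfolding integrable_Cauchy_weight(2)[OF sets one] by simp
qed

text \<open>For a finite measure the correction \<open>l / (1 + l\<^sup>2)\<close> of the kernel can be integrated separately and
  joins the constant, leaving the Cauchy transform, which is bounded by the total mass over \<open>y\<close>.
  The second bound holds because \<open>y\<^sup>2 / (l\<^sup>2 + y\<^sup>2) \<ge> 1 / (1 + l\<^sup>2)\<close> for \<open>y \<ge> 1\<close>.\<close>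

lemma finite_measure_asymptotics:
  assumes sets [measurable_cong]: "sets \<mu> = sets borel"
    and fin: "emeasure \<mu> UNIV \<noteq> \<infinity>"
    and one: "(\<integral>\<^sup>+ l. ennreal (1 / (1 + l\<^sup>2)) \<partial>\<mu>) = 1"
    and rep: "\<And>z. Im z > 0 \<Longrightarrow> F z = of_real q + (LINT l|\<mu>. nkernel z l)"
  obtains c m where "\<And>y. y \<ge> 1 \<Longrightarrow> cmod (F (\<i> * of_real y) - of_real c) \<le> m / y"
    and "\<And>y. y \<ge> 1 \<Longrightarrow> y * Im (F (\<i> * of_real y)) \<ge> 1"
proof -
  have space [simp]: "space \<mu> = UNIV" using sets_eq_imp_space_eq[OF sets] by simp
  interpret finite_measure \<mu> by (rule finite_measureI) (use fin in simp)
  have int0: "integrable \<mu> (\<lambda>l. l / (1 + l\<^sup>2))"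
  proof (rule integrable_const_bound[of _ 1])
    show "AE l in \<mu>. norm (l / (1 + l\<^sup>2)) \<le> 1"
    proof (rule AE_I2)
      fix l :: real
      have "2 * \<bar>l\<bar> \<le> 1 + l\<^sup>2" using zero_le_power2[of "\<bar>l\<bar> - 1"] by (simp add: power2_diff)
      then show "norm (l / (1 + l\<^sup>2)) \<le> 1"
        using one_plus_square_pos[of l] by (simp add: divide_le_eq)
    qed
  qed measurable
  define c where "c = q - (LINT l|\<mu>. l / (1 + l\<^sup>2))"
  define m where "m = measure \<mu> UNIV"
  show thesis
  proof (rule that[of c m])
    fix y :: real assume y: "y \<ge> 1"
    then have y0: "y > 0" by simp
    have int1: "integrable \<mu> (\<lambda>l. 1 / (complex_of_real l - \<i> * of_real y))"
      by (rule integrable_const_bound[of _ "1 / y"])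
         (use norm_resolvent_kernel(2)[OF y0] in \<open>auto intro!: AE_I2\<close>)
    have "F (\<i> * of_real y) = of_real q + (LINT l|\<mu>. 1 / (complex_of_real l - \<i> * of_real y))
        - (LINT l|\<mu>. complex_of_real (l / (1 + l\<^sup>2)))"
      using rep[of "\<i> * of_real y"] y0
        Bochner_Integration.integral_diff[OF int1 integrable_of_real[OF int0]] by simp
    then have eq: "F (\<i> * of_real y) - of_real c = (LINT l|\<mu>. 1 / (complex_of_real l - \<i> * of_real y))"
      unfolding integral_complex_of_real c_def by simp
    have "cmod (LINT l|\<mu>. 1 / (complex_of_real l - \<i> * of_real y))
        \<le> (LINT l|\<mu>. cmod (1 / (complex_of_real l - \<i> * of_real y)))"
      by (rule integral_norm_bound)
    also have "\<dots> \<le> (LINT l|\<mu>. 1 / y)"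
      by (rule integral_mono) (use int1 norm_resolvent_kernel(2)[OF y0] in auto)
    also have "\<dots> = m / y" by (simp add: m_def)
    finally show "cmod (F (\<i> * of_real y) - of_real c) \<le> m / y" unfolding eq .
    have "Im (F (\<i> * of_real y)) = (LINT l|\<mu>. y / (l\<^sup>2 + y\<^sup>2))"
      using rep[of "\<i> * of_real y"] Im_Nevanlinna_integral(2)[OF sets one y] y0 by simp
    then have "y * Im (F (\<i> * of_real y)) = (LINT l|\<mu>. y * (y / (l\<^sup>2 + y\<^sup>2)))"
      by (simp only: integral_mult_right_zero)
    also have "\<dots> \<ge> (LINT l|\<mu>. 1 / (1 + l\<^sup>2))"
    proof (rule integral_mono)
      show "integrable \<mu> (\<lambda>l. 1 / (1 + l\<^sup>2))" by (rule integrable_Cauchy_weight[OF sets one])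
      show "integrable \<mu> (\<lambda>l. y * (y / (l\<^sup>2 + y\<^sup>2)))"
        by (intro integrable_mult_right Im_Nevanlinna_integral(1)[OF sets one y])
      fix l :: real
      have "1 \<le> y\<^sup>2" using y by (simp add: one_le_power)
      then have "l\<^sup>2 * 1 \<le> l\<^sup>2 * y\<^sup>2" by (intro mult_left_mono) auto
      then have "l\<^sup>2 + y\<^sup>2 \<le> y\<^sup>2 * (1 + l\<^sup>2)" by (simp add: algebra_simps)
      then show "1 / (1 + l\<^sup>2) \<le> y * (y / (l\<^sup>2 + y\<^sup>2))"
        using one_plus_square_pos[of l] y0
        by (simp add: divide_le_eq le_divide_eq add_nonneg_pos power2_eq_square mult_ac)
    qed
    finally show "y * Im (F (\<i> * of_real y)) \<ge> 1"
      unfolding integrable_Cauchy_weight(2)[OF sets one] .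
  qed
qed

section \<open>Moebius transforms of functions with a Nevanlinna representation\<close>

lemma Im_neg_reciprocal:
  assumes "u * v = - complex_of_real K" "K > 0"
  shows "u \<noteq> 0" "Im v = K * Im u / (cmod u)\<^sup>2"
proof -
  show u: "u \<noteq> 0" using assms by auto
  have "v * of_real ((cmod u)\<^sup>2) = (u * v) * cnj u" by (simp only: complex_norm_square mult_ac)
  also have "\<dots> = - (of_real K * cnj u)" by (simp add: assms(1))
  finally have "Im (v * of_real ((cmod u)\<^sup>2)) = Im (- (of_real K * cnj u))" by (rule arg_cong)
  then have "Im v * (cmod u)\<^sup>2 = K * Im u" by (simp del: of_real_power)
  then show "Im v = K * Im u / (cmod u)\<^sup>2" using u by (simp add: eq_divide_eq)
qed

text \<open>The relation is symmetric in \<open>V - t\<close> and \<open>F + t\<close>, so \<open>Im F = (1 + t\<^sup>2) Im V / |V - t|\<^sup>2\<close> and conversely.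
  The first formula bounds \<open>Im F(iy)\<close> by \<open>(1 + t\<^sup>2) / Im V(iy)\<close>, which is \<open>o(y)\<close>.  If the measure of \<open>F\<close>
  were finite, \<open>F(iy) + t\<close> would either stay away from zero, and the second formula would bound
  \<open>y Im V(iy)\<close>, or be \<open>O(1/y)\<close>, and then \<open>Im V(iy) / y\<close> would be bounded below.\<close>

theorem M_class_moebius:
  assumes V: "V \<in> M_class Q"
    and rel: "\<And>z. Im z > 0 \<Longrightarrow> (F z + of_real t) * (V z - of_real t) = - of_real (1 + t\<^sup>2)"
    and Fi: "Im (F \<i>) = 1"
  shows "F \<in> M_class (Re (F \<i>))"
proof -
  note K = one_plus_square_pos[of t]
  have rel': "(V z - of_real t) * (F z + of_real t) = - of_real (1 + t\<^sup>2)" if "Im z > 0" for z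
    using rel[OF that] by (simp only: mult.commute)
  have VH: "V holomorphic_on {z. Im z > 0}" and Vpos: "\<And>z. Im z > 0 \<Longrightarrow> Im (V z) > 0"
    using V by (auto simp: M_class_def herglotz_nevanlinna_def)
  have Vt: "V z - of_real t \<noteq> 0" if "Im z > 0" for z
    using Im_neg_reciprocal(1)[OF rel'[OF that] K] .
  have ImF: "Im (F z) = (1 + t\<^sup>2) * Im (V z) / (cmod (V z - of_real t))\<^sup>2" if "Im z > 0" for z
    using Im_neg_reciprocal(2)[OF rel'[OF that] K] by simp
  have ImV: "Im (V z) = (1 + t\<^sup>2) * Im (F z) / (cmod (F z + of_real t))\<^sup>2" if "Im z > 0" for z
    using Im_neg_reciprocal(2)[OF rel[OF that] K] by simp
  have F: "herglotz_nevanlinna F"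
    unfolding herglotz_nevanlinna_def
  proof (intro conjI allI impI)
    have "(\<lambda>z. - of_real (1 + t\<^sup>2) / (V z - of_real t) - of_real t) holomorphic_on {z. Im z > 0}"
      by (intro holomorphic_intros VH) (use Vt in auto)
    then show "F holomorphic_on {z. Im z > 0}"
    proof (rule holomorphic_transform)
      fix z :: complex assume "z \<in> {z. Im z > 0}"
      then have z: "Im z > 0" by simp
      have "F z + of_real t = - of_real (1 + t\<^sup>2) / (V z - of_real t)"
        by (simp only: nonzero_eq_divide_eq[OF Vt[OF z]] rel[OF z])
      then show "- of_real (1 + t\<^sup>2) / (V z - of_real t) - of_real t = F z"
        by (metis add_diff_cancel_right')
    qed
    show "Im (F z) > 0" if "Im z > 0" for z
      using Vpos[OF that] Vt[OF that] K by (simp add: ImF[OF that])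
  qed
  note asym = M_class_asymptotics[OF V]
  have z: "Im (\<i> * of_real (height n)) > 0" for n using height_ge_1[of n] by simp
  have sub: "\<exists>y>0. Im (F (\<i> * of_real y)) < b * y" if b: "b > 0" for b
  proof -
    have "eventually (\<lambda>n. height n * Im (V (\<i> * of_real (height n))) > (1 + t\<^sup>2) / b) sequentially"
      using asym(2) by (simp add: filterlim_at_top_dense)
    then obtain n where n: "height n * Im (V (\<i> * of_real (height n))) > (1 + t\<^sup>2) / b"
      by (auto simp: eventually_sequentially)
    define v where "v = V (\<i> * of_real (height n))"
    have v: "Im v > 0" unfolding v_def by (rule Vpos[OF z])
    have "Im v \<le> cmod (v - of_real t)" using abs_Im_le_cmod[of "v - of_real t"] v by simp
    then have "(Im v)\<^sup>2 \<le> (cmod (v - of_real t))\<^sup>2" using v by (simp add: power_mono)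
    then have "Im (F (\<i> * of_real (height n))) \<le> (1 + t\<^sup>2) * Im v / (Im v)\<^sup>2"
      unfolding ImF[OF z] v_def[symmetric] using v K
      by (intro divide_left_mono) (auto intro!: mult_pos_pos)
    also have "\<dots> = (1 + t\<^sup>2) / Im v" using v by (simp add: power2_eq_square)
    also have "\<dots> < b * height n"
      using n[folded v_def] v b by (simp add: divide_less_eq mult_ac)
    finally show ?thesis using height_ge_1[of n] by (intro exI[of _ "height n"]) simp
  qed
  obtain \<mu> :: "real measure" where sets: "sets \<mu> = sets borel"
    and one: "(\<integral>\<^sup>+ l. ennreal (1 / (1 + l\<^sup>2)) \<partial>\<mu>) = 1"
    and rep: "\<And>z. Im z > 0 \<Longrightarrow> F z = of_real (Re (F \<i>)) + (LINT l|\<mu>. nkernel z l)"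
    by (rule Nevanlinna_representation_sublinear[OF F Fi sub], assumption, rule that)
  have "emeasure \<mu> UNIV = \<infinity>"
  proof (rule ccontr)
    assume "emeasure \<mu> UNIV \<noteq> \<infinity>"
    then have fin: "emeasure \<mu> UNIV \<noteq> \<infinity>" .
    obtain c m where bound: "\<And>y. y \<ge> 1 \<Longrightarrow> cmod (F (\<i> * of_real y) - of_real c) \<le> m / y"
      and lower: "\<And>y. y \<ge> 1 \<Longrightarrow> y * Im (F (\<i> * of_real y)) \<ge> 1"
      by (rule finite_measure_asymptotics[OF sets fin one rep], assumption, rule that)
    have upper: "y * Im (F (\<i> * of_real y)) \<le> m" if "y \<ge> 1" for y
    proof -
      have "Im (F (\<i> * of_real y)) \<le> m / y"
        using abs_Im_le_cmod[of "F (\<i> * of_real y) - of_real c"] bound[OF that] by simp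
      then show ?thesis using that by (simp add: le_divide_eq mult.commute)
    qed
    have m: "m \<ge> 1" using upper[of 1] lower[of 1] by simp
    show False
    proof (cases "c + t = 0")
      case True
      have "(1 + t\<^sup>2) / m\<^sup>2 \<le> Im (V (\<i> * of_real (height n))) / height n" for n
      proof -
        define y where "y = height n"
        define f where "f = F (\<i> * of_real y)"
        have y: "y \<ge> 1" "y > 0" using height_ge_1[of n] by (simp_all add: y_def)
        have zy: "Im (\<i> * of_real y) > 0" using y by simp
        have ct: "of_real t = - complex_of_real c" using True by (simp add: eq_neg_iff_add_eq_0 add.commute flip: of_real_add of_real_minus)
        have f0: "f + of_real t \<noteq> 0" unfolding f_def using Im_neg_reciprocal(1)[OF rel[OF zy] K] .
        have "cmod (f + of_real t) \<le> m / y" using bound[OF y(1)] by (simp add: f_def ct)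
        then have le: "(cmod (f + of_real t))\<^sup>2 \<le> (m / y)\<^sup>2" by (simp add: power_mono)
        have "(1 + t\<^sup>2) / m\<^sup>2 = ((1 + t\<^sup>2) * (1 / y)) / (m / y)\<^sup>2 / y"
          using y m by (simp add: power_divide) (simp add: power2_eq_square field_simps)
        also have "\<dots> \<le> ((1 + t\<^sup>2) * Im f) / (cmod (f + of_real t))\<^sup>2 / y"
        proof (intro divide_right_mono frac_le mult_left_mono le)
          show "1 / y \<le> Im f" using lower[OF y(1)] y by (simp add: f_def divide_le_eq mult.commute)
          then show "0 \<le> (1 + t\<^sup>2) * Im f" using K y by (smt (verit) divide_pos_pos mult_pos_pos)
          show "0 < (cmod (f + of_real t))\<^sup>2" using f0 by simp
        qed (use K y in auto)
        also have "\<dots> = Im (V (\<i> * of_real y)) / y" using ImV[OF zy] by (simp add: f_def)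
        finally show ?thesis by (simp add: y_def)
      qed
      then have "(1 + t\<^sup>2) / m\<^sup>2 \<le> 0" by (intro LIMSEQ_le_const[OF asym(1)]) auto
      moreover have "0 < (1 + t\<^sup>2) / m\<^sup>2" using K m by simp
      ultimately show False by simp
    next
      case False
      define a where "a = \<bar>c + t\<bar>"
      have a: "a > 0" using False by (simp add: a_def)
      have "eventually (\<lambda>n. height n \<ge> 2 * m / a) sequentially"
        using filterlim_height unfolding filterlim_at_top by blast
      moreover have "eventually (\<lambda>n. height n * Im (V (\<i> * of_real (height n))) > (1 + t\<^sup>2) * m / (a / 2)\<^sup>2) sequentially"
        using asym(2) by (simp add: filterlim_at_top_dense)
      ultimately have "eventually (\<lambda>n. False) sequentially"
      proof eventually_elim
        case (elim n)
        define y where "y = height n"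
        define f where "f = F (\<i> * of_real y)"
        have y: "y \<ge> 1" "y > 0" using height_ge_1[of n] by (simp_all add: y_def)
        have zy: "Im (\<i> * of_real y) > 0" using y by simp
        have "m / y \<le> a / 2" using elim(1) y a by (simp add: y_def field_simps)
        moreover have "a \<le> cmod (f + of_real t) + cmod (f - of_real c)"
        proof -
          have "a = cmod ((f + of_real t) - (f - of_real c))"
            by (simp add: a_def add.commute flip: of_real_add)
          also have "\<dots> \<le> cmod (f + of_real t) + cmod (f - of_real c)" by (rule norm_triangle_ineq4)
          finally show ?thesis .
        qed
        moreover have "cmod (f - of_real c) \<le> m / y" unfolding f_def by (rule bound[OF y(1)])
        ultimately have "a / 2 \<le> cmod (f + of_real t)" by linarith
        then have le: "(a / 2)\<^sup>2 \<le> (cmod (f + of_real t))\<^sup>2" using a by (intro power_mono) auto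
        have "y * Im (V (\<i> * of_real y)) = (1 + t\<^sup>2) * (y * Im f) / (cmod (f + of_real t))\<^sup>2"
          using ImV[OF zy] by (simp add: f_def)
        also have "\<dots> \<le> (1 + t\<^sup>2) * m / (a / 2)\<^sup>2"
          using upper[OF y(1)] K a m le by (intro frac_le mult_left_mono) (auto simp: f_def)
        finally show False using elim(2) by (simp add: y_def)
      qed
      then show False by simp
    qed
  qed
  then show ?thesis unfolding M_class_def using F sets one rep by blast
qed

section \<open>Impedance functions with opposite constants\<close>

theorem theorem9:
  fixes Q \<alpha> :: real
    and \<Theta> :: "'h::chilbert_space L_sys"
    and \<Theta>\<^sub>\<alpha> :: "'k::chilbert_space L_sys"
  assumes "Q \<noteq> 0"
    and "minimal_L_system \<Theta>"
    and "impedance_fun \<Theta> \<in> M_class Q"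
    and "unimodular_transformation \<alpha> \<Theta> \<Theta>\<^sub>\<alpha>"
    and "\<alpha> \<noteq> pi / 2"
  shows "impedance_fun \<Theta>\<^sub>\<alpha> \<in> M_class (- Q) \<longleftrightarrow> tan \<alpha> = Q / 2"
proof -
  define F where "F = impedance_fun \<Theta>\<^sub>\<alpha>"
  define t where "t = tan \<alpha>"
  have "0 \<le> \<alpha>" "\<alpha> < pi" using assms(4) by (simp_all add: unimodular_transformation_def)
  then have c: "cos \<alpha> \<noteq> 0"
    using assms(5) cos_gt_zero_pi[of \<alpha>] cos_gt_zero_pi[of "pi - \<alpha>"] by (cases "\<alpha> < pi / 2") auto
  have "L_system \<Theta>" using assms(2) by (simp add: minimal_L_system_def)
  from unimodular_impedance_relation[OF this assms(4) c]
  have rel: "(F z + of_real t) * (impedance_fun \<Theta> z - of_real t) = - of_real (1 + t\<^sup>2)"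
    if "Im z > 0" for z
    using that by (simp add: F_def t_def)
  have at_i: "(F \<i> + of_real t) * (of_real Q + \<i> - of_real t) = - of_real (1 + t\<^sup>2)"
    using rel[of \<i>] M_class_asymptotics(3)[OF assms(3)] by simp
  have "F \<in> M_class (- Q) \<longleftrightarrow> t = Q / 2"
  proof
    assume "F \<in> M_class (- Q)"
    from M_class_asymptotics(3)[OF this] have Fi: "F \<i> = of_real (- Q) + \<i>" .
    have "(of_real (- Q) + \<i> + of_real t) * (of_real Q + \<i> - of_real t)
        = - complex_of_real (1 + (Q - t)\<^sup>2)"
      by (simp add: power2_eq_square algebra_simps)
    then have "complex_of_real (1 + (Q - t)\<^sup>2) = of_real (1 + t\<^sup>2)"
      using at_i unfolding Fi by simp
    then have "(Q - t)\<^sup>2 = t\<^sup>2" by (simp only: of_real_eq_iff)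
    then have "Q * (Q - 2 * t) = 0" by (simp add: power2_eq_square algebra_simps)
    then show "t = Q / 2" using assms(1) by simp
  next
    assume t: "t = Q / 2"
    have nz: "of_real t + \<i> \<noteq> 0" by (simp add: complex_eq_iff)
    have "of_real Q + \<i> - of_real t = complex_of_real t + \<i>" by (simp add: t)
    then have "(F \<i> + of_real t) * (of_real t + \<i>) = (\<i> - of_real t) * (of_real t + \<i>)"
      using at_i by (simp add: power2_eq_square algebra_simps)
    then have "F \<i> + of_real t = \<i> - of_real t" using nz by simp
    then have Fi: "F \<i> = of_real (- Q) + \<i>" by (simp add: t complex_eq_iff)
    have "F \<in> M_class (Re (F \<i>))"
      by (rule M_class_moebius[OF assms(3) rel]) (simp_all add: Fi)
    then show "F \<in> M_class (- Q)" by (simp add: Fi)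
  qed
  then show ?thesis by (simp add: F_def t_def)
qed

end
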